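(* For the reversible nearest-neighbour PCA described in the context, $\Gamma_m=\Gamma^{\mathrm{PCA}}$ and thus $\mathcal{X}^m=\{\underline{-1},\underline{c}\}$, i.e. $\mathcal{X}^m=\{\underline{-1},\underline{c}^e,\underline{c}^o\}$.
   Context: Let $L$ be even, $\Lambda=\{0,\dots,L-1\}^2$ the two-dimensional torus (periodic boundary conditions, Euclidean metric), $\mathcal{X}=\{-1,+1\}^\Lambda$, and let $h\in(0,1)$ be fixed and small (external magnetic field). Put $S_\sigma(i)=\sum_{j\in\Lambda:|i-j|=1}\sigma(j)$. For $\beta>0$ the reversible Probabilistic Cellular Automaton (PCA) is the Markov chain on $\mathcal{X}$ with transition probabilities $p(\sigma,\eta)=\prod_{i\in\Lambda}p_{i,\sigma}(\eta(i))$, where $p_{i,\sigma}(a)=\frac1{1+\exp\{-2\beta a(S_\sigma(i)+h)\}}$, $a\in\{-1,+1\}$. The virtual energy is $H(\sigma)=-h\sum_{i\in\Lambda}\sigma(i)-\sum_{i\in\Lambda}|S_\sigma(i)+h|$, and the energy cost is $\Delta(\sigma,\eta)=-\lim_{\beta\to\infty}\frac{\log p(\sigma,\eta)}{\beta}=\sum_{i\in\Lambda:\,\eta(i)(S_\sigma(i)+h)<0}2|S_\sigma(i)+h|$. The transition energy is $H(\sigma,\eta):=H(\sigma)+\Delta(\sigma,\eta)$. A path is a finite sequence $\omega=(\omega_1,\dots,\omega_n)$ of configurations; its height is $\Phi_\omega=H(\omega_1)$ if $|\omega|=1$ and $\Phi_\omega=\max_{i<|\omega|}H(\omega_i,\omega_{i+1})$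 if $|\omega|>1$. $\Phi(\sigma,\eta)$ is the minimum of $\Phi_\omega$ over all paths from $\sigma$ to $\eta$, and $\Phi(A,B):=\min_{\sigma\in A,\eta\in B}\Phi(\sigma,\eta)$. With $\mathcal{I}_\sigma:=\{\eta\mid H(\eta)<H(\sigma)\}$, the stability level is $V_\sigma:=\Phi(\sigma,\mathcal{I}_\sigma)-H(\sigma)$ ($=\infty$ if $\mathcal{I}_\sigma=\emptyset$). $\mathcal{X}^s$ is the set of global minima of $H$, $\Gamma_m:=\max_{\sigma\in\mathcal{X}\setminus\mathcal{X}^s}V_\sigma$, and $\mathcal{X}^m:=\{\sigma\in\mathcal{X}\mid V_\sigma=\Gamma_m\}$ is the set of metastable states. $\underline{+1}$ and $\underline{-1}$ are the constant configurations; $\underline{c}^e(i)=(-1)^{i_1+i_2}$ and $\underline{c}^o(i)=(-1)^{i_1+i_2+1}$ for $i=(i_1,i_2)\in\Lambda$ are the chessboard configurations, and $\underline{c}$ is shorthand for $\{\underline{c}^e,\underline{c}^o\}$. The critical length is $\lambda:=[2/h]+1$, $[\cdot]$ being the integer part, and $\Gamma^{\mathrm{PCA}}:=-2h\lambda^2+2\lambda(4+h)-2h$.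
   Formalization: The claim is proved for every h below some h0 and every even L at least some L0(h); for L small relative to 1/h it fails (e.g. L=4, h=0.01: stability levels are at most about 128 while Gamma^PCA is about 804). *)

theory Defs
  imports Complex_Main "HOL-Library.FuncSet" "HOL-Library.Extended_Real" "HOL-Real_Asymp.Real_Asymp"
begin

definition torus :: "nat \<Rightarrow> (nat \<times> nat) set" where
  "torus L = {..<L} \<times> {..<L}"

definition cyc_dist :: "nat \<Rightarrow> nat \<Rightarrow> nat \<Rightarrow> real" where
  "cyc_dist L a b = min \<bar>real a - real b\<bar> (real L - \<bar>real a - real b\<bar>)"

text \<open>Euclidean metric with periodic boundary conditions.\<close>

definition torus_dist :: "nat \<Rightarrow> nat \<times> nat \<Rightarrow> nat \<times> nat \<Rightarrow> real" where
  "torus_dist L i j = sqrt ((cyc_dist L (fst i) (fst j))\<^sup>2 + (cyc_dist L (snd i) (snd j))\<^sup>2)"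

text \<open>Configurations are extensional functions (\<open>undefined\<close> off the torus), so that equality of
  functions is equality of configurations.\<close>

type_synonym config = "nat \<times> nat \<Rightarrow> real"

definition configs :: "nat \<Rightarrow> config set" where
  "configs L = torus L \<rightarrow>\<^sub>E {-1, 1}"

definition nbsum :: "nat \<Rightarrow> config \<Rightarrow> nat \<times> nat \<Rightarrow> real" where
  "nbsum L \<sigma> i = (\<Sum>j | j \<in> torus L \<and> torus_dist L i j = 1. \<sigma> j)"

definition site_prob :: "real \<Rightarrow> real \<Rightarrow> nat \<Rightarrow> config \<Rightarrow> nat \<times> nat \<Rightarrow> real \<Rightarrow> real" where
  "site_prob \<beta> h L \<sigma> i a = 1 / (1 + exp (- 2 * \<beta> * a * (nbsum L \<sigma> i + h)))"

definition trans_prob :: "real \<Rightarrow> real \<Rightarrow> nat \<Rightarrow> config \<Rightarrow> config \<Rightarrow> real" where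
  "trans_prob \<beta> h L \<sigma> \<eta> = (\<Prod>i\<in>torus L. site_prob \<beta> h L \<sigma> i (\<eta> i))"

definition energy :: "real \<Rightarrow> nat \<Rightarrow> config \<Rightarrow> real" where
  "energy h L \<sigma> = - h * (\<Sum>i\<in>torus L. \<sigma> i) - (\<Sum>i\<in>torus L. \<bar>nbsum L \<sigma> i + h\<bar>)"

definition cost :: "real \<Rightarrow> nat \<Rightarrow> config \<Rightarrow> config \<Rightarrow> real" where
  "cost h L \<sigma> \<eta> = - Lim at_top (\<lambda>\<beta>. ln (trans_prob \<beta> h L \<sigma> \<eta>) / \<beta>)"

definition trans_energy :: "real \<Rightarrow> nat \<Rightarrow> config \<Rightarrow> config \<Rightarrow> real" where
  "trans_energy h L \<sigma> \<eta> = energy h L \<sigma> + cost h L \<sigma> \<eta>"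

text \<open>All transition probabilities are positive, so any two configurations may be consecutive
  in a path.\<close>

definition paths :: "nat \<Rightarrow> config \<Rightarrow> config \<Rightarrow> config list set" where
  "paths L \<sigma> \<eta> = {\<omega>. \<omega> \<noteq> [] \<and> set \<omega> \<subseteq> configs L \<and> hd \<omega> = \<sigma> \<and> last \<omega> = \<eta>}"

definition height :: "real \<Rightarrow> nat \<Rightarrow> config list \<Rightarrow> real" where
  "height h L \<omega> =
     (if length \<omega> = 1 then energy h L (hd \<omega>)
      else Max {trans_energy h L (\<omega> ! k) (\<omega> ! Suc k) | k. Suc k < length \<omega>})"

definition comm_height :: "real \<Rightarrow> nat \<Rightarrow> config \<Rightarrow> config \<Rightarrow> real" where
  "comm_height h L \<sigma> \<eta> = Min (height h L ` paths L \<sigma> \<eta>)"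

definition comm_height_set :: "real \<Rightarrow> nat \<Rightarrow> config set \<Rightarrow> config set \<Rightarrow> real" where
  "comm_height_set h L A B = Min {comm_height h L \<sigma> \<eta> | \<sigma> \<eta>. \<sigma> \<in> A \<and> \<eta> \<in> B}"

definition lower :: "real \<Rightarrow> nat \<Rightarrow> config \<Rightarrow> config set" where
  "lower h L \<sigma> = {\<eta> \<in> configs L. energy h L \<eta> < energy h L \<sigma>}"

definition stab_level :: "real \<Rightarrow> nat \<Rightarrow> config \<Rightarrow> ereal" where
  "stab_level h L \<sigma> =
     (if lower h L \<sigma> = {} then \<infinity>
      else ereal (comm_height_set h L {\<sigma>} (lower h L \<sigma>) - energy h L \<sigma>))"

definition stable_states :: "real \<Rightarrow> nat \<Rightarrow> config set" where
  "stable_states h L = {\<sigma> \<in> configs L. \<forall>\<eta>\<in>configs L. energy h L \<sigma> \<le> energy h L \<eta>}"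

definition Gamma_m :: "real \<Rightarrow> nat \<Rightarrow> ereal" where
  "Gamma_m h L = Max (stab_level h L ` (configs L - stable_states h L))"

definition metastable_states :: "real \<Rightarrow> nat \<Rightarrow> config set" where
  "metastable_states h L = {\<sigma> \<in> configs L. stab_level h L \<sigma> = Gamma_m h L}"

definition all_minus :: "nat \<Rightarrow> config" where
  "all_minus L = (\<lambda>i\<in>torus L. -1)"

definition chess_even :: "nat \<Rightarrow> config" where
  "chess_even L = (\<lambda>i\<in>torus L. (-1) ^ (fst i + snd i))"

definition chess_odd :: "nat \<Rightarrow> config" where
  "chess_odd L = (\<lambda>i\<in>torus L. (-1) ^ (fst i + snd i + 1))"

definition crit_length :: "real \<Rightarrow> int" where
  "crit_length h = \<lfloor>2 / h\<rfloor> + 1"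

definition Gamma_PCA :: "real \<Rightarrow> real" where
  "Gamma_PCA h = - 2 * h * (of_int (crit_length h))\<^sup>2 + 2 * of_int (crit_length h) * (4 + h) - 2 * h"


text \<open>The limit defining the cost exists and has the expected value.\<close>

lemma site_limit:
  fixes x :: real
  shows "((\<lambda>\<beta>. ln (1 / (1 + exp (- 2 * \<beta> * x))) / \<beta>) \<longlongrightarrow> (if x < 0 then 2 * x else 0)) at_top"
proof -
  consider "x < 0" | "x = 0" | "x > 0" by linarith
  then show ?thesis
  proof cases
    case 1
    define y where "y = - x"
    have "y > 0" using 1 by (simp add: y_def)
    have "((\<lambda>\<beta>. ln (1 / (1 + exp (2 * \<beta> * y))) / \<beta>) \<longlongrightarrow> - 2 * y) at_top"
      using \<open>y > 0\<close> by real_asymp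
    then show ?thesis using 1 by (simp add: y_def)
  next
    case 2
    have "((\<lambda>\<beta>::real. ln (1 / (1 + 1)) / \<beta>) \<longlongrightarrow> 0) at_top" by real_asymp
    then show ?thesis using 2 by simp
  next
    case 3
    then have "((\<lambda>\<beta>. ln (1 / (1 + exp (- 2 * \<beta> * x))) / \<beta>) \<longlongrightarrow> 0) at_top" by real_asymp
    then show ?thesis using 3 by simp
  qed
qed

lemma finite_torus [simp]: "finite (torus L)"
  by (simp add: torus_def)

lemma finite_configs [simp]: "finite (configs L)"
  by (simp add: configs_def finite_PiE)

lemma trans_prob_limit:
  assumes "\<eta> \<in> configs L"
  shows "((\<lambda>\<beta>. ln (trans_prob \<beta> h L \<sigma> \<eta>) / \<beta>) \<longlongrightarrow>
     - (\<Sum>i | i \<in> torus L \<and> \<eta> i * (nbsum L \<sigma> i + h) < 0. 2 * \<bar>nbsum L \<sigma> i + h\<bar>)) at_top"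
proof -
  let ?x = "\<lambda>i. \<eta> i * (nbsum L \<sigma> i + h)"
  have pos: "site_prob \<beta> h L \<sigma> i a > 0" for \<beta> i a
    by (simp add: site_prob_def add_pos_pos)
  have ln: "ln (trans_prob \<beta> h L \<sigma> \<eta>) / \<beta> = (\<Sum>i\<in>torus L. ln (1 / (1 + exp (- 2 * \<beta> * ?x i))) / \<beta>)" for \<beta>
  proof -
    have "ln (trans_prob \<beta> h L \<sigma> \<eta>) = (\<Sum>i\<in>torus L. ln (site_prob \<beta> h L \<sigma> i (\<eta> i)))"
      unfolding trans_prob_def by (rule ln_prod) (use pos in \<open>auto simp: less_imp_neq [THEN not_sym]\<close>)
    then show ?thesis by (simp add: sum_divide_distrib site_prob_def mult.assoc)
  qed
  have abs: "\<bar>nbsum L \<sigma> i + h\<bar> = \<bar>?x i\<bar>" if "i \<in> torus L" for i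
  proof -
    have "\<eta> i \<in> {-1, 1}" using assms that by (auto simp: configs_def PiE_iff)
    then show ?thesis by auto
  qed
  have "(\<Sum>i\<in>torus L. if ?x i < 0 then 2 * ?x i else 0)
      = (\<Sum>i | i \<in> torus L \<and> ?x i < 0. 2 * ?x i)"
    by (simp add: sum.inter_filter)
  also have "\<dots> = - (\<Sum>i | i \<in> torus L \<and> ?x i < 0. 2 * \<bar>nbsum L \<sigma> i + h\<bar>)"
    unfolding sum_negf [symmetric] by (intro sum.cong) (use abs in auto)
  finally have eq: "(\<Sum>i\<in>torus L. if ?x i < 0 then 2 * ?x i else 0) = \<dots>" .
  show ?thesis
    unfolding ln eq [symmetric] by (intro tendsto_sum site_limit)
qed

lemma cost_eq:
  assumes "\<eta> \<in> configs L"
  shows "cost h L \<sigma> \<eta> =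
     (\<Sum>i | i \<in> torus L \<and> \<eta> i * (nbsum L \<sigma> i + h) < 0. 2 * \<bar>nbsum L \<sigma> i + h\<bar>)"
  using tendsto_Lim [OF _ trans_prob_limit [OF assms]] by (simp add: cost_def)

text \<open>There are infinitely many paths, but the minimum in \<open>comm_height\<close> ranges over a finite
  nonempty set of heights.\<close>

lemma finite_heights: "finite (height h L ` paths L \<sigma> \<eta>)"
proof (rule finite_subset)
  let ?T = "(\<lambda>(\<sigma>, \<eta>). trans_energy h L \<sigma> \<eta>) ` (configs L \<times> configs L)"
  show "height h L ` paths L \<sigma> \<eta> \<subseteq> energy h L ` configs L \<union> ?T"
  proof (rule image_subsetI)
    fix \<omega> assume "\<omega> \<in> paths L \<sigma> \<eta>"
    then have \<omega>: "\<omega> \<noteq> []" "set \<omega> \<subseteq> configs L" by (auto simp: paths_def)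
    show "height h L \<omega> \<in> energy h L ` configs L \<union> ?T"
    proof (cases "length \<omega> = 1")
      case True
      moreover have "hd \<omega> \<in> configs L" using \<omega> by auto
      ultimately show ?thesis by (simp add: height_def)
    next
      case False
      let ?S = "{trans_energy h L (\<omega> ! k) (\<omega> ! Suc k) | k. Suc k < length \<omega>}"
      have "Suc 0 < length \<omega>" using \<omega>(1) False by (cases \<omega>) auto
      then have "?S \<noteq> {}" by blast
      moreover have sub: "?S \<subseteq> ?T"
      proof clarify
        fix k assume "Suc k < length \<omega>"
        then have "\<omega> ! k \<in> configs L" "\<omega> ! Suc k \<in> configs L"
          using \<omega>(2) nth_mem [of k \<omega>] nth_mem [of "Suc k" \<omega>] by auto
        then show "trans_energy h L (\<omega> ! k) (\<omega> ! Suc k) \<in> ?T" by force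
      qed
      moreover have "finite ?S" by (rule finite_subset [OF sub]) simp
      ultimately have "Max ?S \<in> ?T" using Max_in [of ?S] by blast
      then show ?thesis using False by (simp add: height_def)
    qed
  qed
qed simp

lemma paths_nonempty:
  assumes "\<sigma> \<in> configs L" "\<eta> \<in> configs L"
  shows "paths L \<sigma> \<eta> \<noteq> {}"
proof -
  have "[\<sigma>, \<eta>] \<in> paths L \<sigma> \<eta>" using assms by (simp add: paths_def)
  then show ?thesis by blast
qed

end

theory Submission
  imports Defs
begin

text \<open>The transition energy is symmetric, and since the torus is bipartite it splits as the sum of
  the energies of two independent Ising models: even spins of \<open>\<sigma>\<close> with odd spins of \<open>\<eta>\<close>, and
  conversely. In terms of the sets of plus spins, a configuration is a pair of subsets of the torus, each
  with energy twice its perimeter minus \<open>2 h\<close> times its area, up to a constant. The states in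
  question are those pairs in which each set is empty or the whole torus, but not both are the whole torus.

  Lower bound: parallel updates factor through single spin flips of no larger height, so one of the empty
  sets has to pass through area \<open>\<lambda> (\<lambda> - 1) + 1\<close>, where its perimeter is at least \<open>4 \<lambda>\<close>.

  Upper bound: if \<open>A\<close> is not the whole torus, follow \<open>A \<union> R\<close> while \<open>R\<close> grows from a single site
  through quasi-squares. By submodularity of the perimeter the energy of \<open>A\<close> increases by at most
  \<open>E(R) - E(A \<inter> R)\<close>. Here \<open>E(R)\<close> never exceeds the barrier, and if \<open>R\<close> starts at a site of \<open>A\<close>
  then the bound stays strictly below it. Once the side of the square \<open>R\<close> exceeds
  \<open>4 / h\<close>, it has less energy than any of its proper subsets, so the energy has dropped strictly,
  provided \<open>R\<close> is not contained in \<open>A\<close>.\<close>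

subsection \<open>Nearest neighbours on the torus\<close>

definition right :: "nat \<Rightarrow> nat \<times> nat \<Rightarrow> nat \<times> nat" where
  "right L z = (Suc (fst z) mod L, snd z)"

definition up :: "nat \<Rightarrow> nat \<times> nat \<Rightarrow> nat \<times> nat" where
  "up L z = (fst z, Suc (snd z) mod L)"

definition left :: "nat \<Rightarrow> nat \<times> nat \<Rightarrow> nat \<times> nat" where
  "left L z = (if fst z = 0 then L - 1 else fst z - 1, snd z)"

definition down :: "nat \<Rightarrow> nat \<times> nat \<Rightarrow> nat \<times> nat" where
  "down L z = (fst z, if snd z = 0 then L - 1 else snd z - 1)"

definition bdry :: "nat \<Rightarrow> (nat \<times> nat \<Rightarrow> nat \<times> nat) \<Rightarrow> (nat \<times> nat) set \<Rightarrow> (nat \<times> nat) set" where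
  "bdry L s A = {z \<in> torus L. (z \<in> A) \<noteq> (s z \<in> A)}"

text \<open>Every edge leads from a unique site to its right or upper neighbour, so for
  \<open>3 \<le> L\<close> this is the size of the edge boundary.\<close>

definition perim :: "nat \<Rightarrow> (nat \<times> nat) set \<Rightarrow> nat" where
  "perim L A = card (bdry L (right L) A) + card (bdry L (up L) A)"

text \<open>The nearest-neighbour Ising energy with unit coupling and field \<open>h\<close>,
  measured from the all-minus state.\<close>

definition ising :: "real \<Rightarrow> nat \<Rightarrow> (nat \<times> nat) set \<Rightarrow> real" where
  "ising h L A = 2 * (real (perim L A) - h * real (card A))"

lemma finite_bdry [simp]: "finite (bdry L s A)"
  by (rule finite_subset [OF _ finite_torus [of L]]) (auto simp: bdry_def)

lemma card_torus: "card (torus L) = L * L"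
  by (simp add: torus_def)

lemma Suc_mod_cases: "a < L \<Longrightarrow> Suc a mod L = (if Suc a = L then 0 else Suc a)"
  by auto

lemma bij_right: "bij_betw (right L) (torus L) (torus L)"
  by (rule bij_betw_byWitness [where f' = "left L"])
     (auto simp: right_def left_def torus_def Suc_mod_cases split: if_splits)

lemma bij_up: "bij_betw (up L) (torus L) (torus L)"
  by (rule bij_betw_byWitness [where f' = "down L"])
     (auto simp: up_def down_def torus_def Suc_mod_cases split: if_splits)

lemma left_right: "z \<in> torus L \<Longrightarrow> left L (right L z) = z"
  by (cases z) (auto simp: right_def left_def torus_def Suc_mod_cases simp del: mod_eq_0_iff_dvd)

lemma down_up: "z \<in> torus L \<Longrightarrow> down L (up L z) = z"
  by (cases z) (auto simp: up_def down_def torus_def Suc_mod_cases simp del: mod_eq_0_iff_dvd)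

lemma shifts_in_torus:
  assumes "z \<in> torus L"
  shows "right L z \<in> torus L" "up L z \<in> torus L" "left L z \<in> torus L" "down L z \<in> torus L"
  using assms by (auto simp: right_def left_def up_def down_def torus_def Suc_mod_cases)

text \<open>Cyclic distances of sites are natural numbers, so unit Euclidean distance becomes a
  question about sums of two squares of naturals.\<close>

lemma cyc_dist_nat:
  assumes "a < L" "b < L"
  shows "cyc_dist L a b = real (min (max a b - min a b) (L - (max a b - min a b)))"
  using assms by (cases "a \<le> b") (auto simp: cyc_dist_def min_def max_def of_nat_diff)

lemma cyc_dist_eq_0_iff:
  assumes "a < L" "b < L"
  shows "cyc_dist L a b = 0 \<longleftrightarrow> a = b"
  using assms by (auto simp: cyc_dist_nat min_def max_def)

lemma cyc_dist_eq_1_iff: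
  assumes "a < L" "b < L" "3 \<le> L"
  shows "cyc_dist L a b = 1 \<longleftrightarrow> b = Suc a mod L \<or> b = (if a = 0 then L - 1 else a - 1)"
proof -
  have "cyc_dist L a b = 1 \<longleftrightarrow> min (max a b - min a b) (L - (max a b - min a b)) = 1"
    using assms by (simp add: cyc_dist_nat del: of_nat_min)
  also have "\<dots> \<longleftrightarrow> b = Suc a mod L \<or> b = (if a = 0 then L - 1 else a - 1)"
    using assms by (auto simp: Suc_mod_cases min_def max_def split: if_splits)
  finally show ?thesis .
qed

lemma sum_squares_eq_1_iff:
  fixes m n :: nat
  shows "m\<^sup>2 + n\<^sup>2 = 1 \<longleftrightarrow> (m = 1 \<and> n = 0) \<or> (m = 0 \<and> n = 1)"
proof
  assume eq: "m\<^sup>2 + n\<^sup>2 = 1"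
  have "m \<le> m\<^sup>2" "n \<le> n\<^sup>2" by (simp_all add: power2_eq_square)
  then have "m \<le> 1" "n \<le> 1" using eq by linarith+
  then show "(m = 1 \<and> n = 0) \<or> (m = 0 \<and> n = 1)"
    using eq by (auto simp: le_Suc_eq)
qed auto

lemma neighbours:
  assumes "i \<in> torus L" "3 \<le> L"
  shows "{j. j \<in> torus L \<and> torus_dist L i j = 1} = {right L i, left L i, up L i, down L i}"
proof -
  obtain a b where i: "i = (a, b)" and ab: "a < L" "b < L"
    using assms by (auto simp: torus_def)
  have "torus_dist L i (c, d) = 1 \<longleftrightarrow>
      (cyc_dist L a c = 1 \<and> b = d) \<or> (a = c \<and> cyc_dist L b d = 1)" if cd: "c < L" "d < L" for c d
  proof -
    obtain m n where m: "cyc_dist L a c = real m" and n: "cyc_dist L b d = real n"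
      using cyc_dist_nat [of a L c] cyc_dist_nat [of b L d] ab cd by metis
    have "torus_dist L i (c, d) = 1 \<longleftrightarrow> (real m)\<^sup>2 + (real n)\<^sup>2 = 1"
      by (simp add: torus_dist_def i m n)
    also have "\<dots> \<longleftrightarrow> m\<^sup>2 + n\<^sup>2 = 1"
      by (simp flip: of_nat_power of_nat_add)
    also have "\<dots> \<longleftrightarrow> (cyc_dist L a c = 1 \<and> cyc_dist L b d = 0) \<or> (cyc_dist L a c = 0 \<and> cyc_dist L b d = 1)"
      using sum_squares_eq_1_iff [of m n] by (simp add: m n)
    finally show ?thesis using ab cd by (simp add: cyc_dist_eq_0_iff)
  qed
  then have *: "torus_dist L i (c, d) = 1 \<longleftrightarrow>
      (c = Suc a mod L \<or> c = (if a = 0 then L - 1 else a - 1)) \<and> b = d \<or> a = c \<and> (d = Suc b mod L \<or> d = (if b = 0 then L - 1 else b - 1))"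
    if "c < L" "d < L" for c d
    using ab that assms(2) by (simp add: cyc_dist_eq_1_iff)
  have "j \<in> torus L \<and> torus_dist L i j = 1 \<longleftrightarrow> j \<in> {right L i, left L i, up L i, down L i}" for j
  proof (cases "j \<in> torus L")
    case True
    then show ?thesis using * [of "fst j" "snd j"]
      by (cases j) (auto simp: right_def left_def up_def down_def i torus_def)
  next
    case False
    then show ?thesis using shifts_in_torus [OF assms(1)] by auto
  qed
  then show ?thesis by blast
qed

text \<open>For \<open>3 \<le> L\<close> the four neighbours are distinct, so the sum over the set
  of neighbours has four terms.\<close>

lemma nbsum_eq:
  assumes "i \<in> torus L" "3 \<le> L"
  shows "nbsum L \<sigma> i = \<sigma> (right L i) + \<sigma> (left L i) + \<sigma> (up L i) + \<sigma> (down L i)"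
proof -
  have "right L i \<noteq> left L i" "up L i \<noteq> down L i" "right L i \<noteq> up L i" "right L i \<noteq> down L i"
    "left L i \<noteq> up L i" "left L i \<noteq> down L i"
    using assms by (auto simp: right_def left_def up_def down_def torus_def Suc_mod_cases
        split: if_splits)
  then show ?thesis by (simp add: nbsum_def neighbours [OF assms])
qed

subsection \<open>Isoperimetry on the torus\<close>

lemma sum_bdry:
  "real (card (bdry L s A)) = (\<Sum>z\<in>torus L. of_bool ((z \<in> A) \<noteq> (s z \<in> A)))"
proof -
  have "bdry L s A = torus L \<inter> {z. (z \<in> A) \<noteq> (s z \<in> A)}"
    by (auto simp: bdry_def)
  then show ?thesis by simp
qed

text \<open>Cut functions are submodular already at a single edge, so the inequality is checked site
  by site.\<close>

lemma bdry_submodular: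
  "card (bdry L s (A \<union> R)) + card (bdry L s (A \<inter> R)) \<le> card (bdry L s A) + card (bdry L s R)"
proof -
  have "real (card (bdry L s (A \<union> R))) + real (card (bdry L s (A \<inter> R)))
      \<le> real (card (bdry L s A)) + real (card (bdry L s R))"
    unfolding sum_bdry sum.distrib [symmetric] by (intro sum_mono) auto
  then show ?thesis by linarith
qed

lemma ising_submodular:
  assumes "finite A" "finite R"
  shows "ising h L (A \<union> R) + ising h L (A \<inter> R) \<le> ising h L A + ising h L R"
proof -
  have "perim L (A \<union> R) + perim L (A \<inter> R) \<le> perim L A + perim L R"
    unfolding perim_def using bdry_submodular [of L "right L" A R] bdry_submodular [of L "up L" A R]
    by linarith
  then have "real (perim L (A \<union> R)) + real (perim L (A \<inter> R)) \<le> real (perim L A) + real (perim L R)"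
    by linarith
  moreover have "real (card (A \<union> R)) + real (card (A \<inter> R)) = real (card A) + real (card R)"
    using card_Un_Int [OF assms] by linarith
  ultimately show ?thesis
    unfolding ising_def by (smt (verit, best) distrib_left)
qed

lemma ising_empty [simp]: "ising h L {} = 0"
  by (simp add: ising_def perim_def bdry_def)

lemma ising_torus: "ising h L (torus L) = - 2 * (h * real (L * L))"
proof -
  have "bdry L (right L) (torus L) = {}" "bdry L (up L) (torus L) = {}"
    using shifts_in_torus by (auto simp: bdry_def)
  then show ?thesis by (simp add: ising_def perim_def card_torus)
qed

lemma ising_ge_torus:
  assumes "0 \<le> h" "A \<subseteq> torus L"
  shows "ising h L (torus L) \<le> ising h L A"
proof -
  have "h * real (card A) \<le> h * real (L * L)"
    using card_mono [OF finite_torus assms(2)] assms(1)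
    by (intro mult_left_mono) (simp_all add: card_torus del: of_nat_mult)
  moreover have "0 \<le> real (perim L A)" by simp
  ultimately show ?thesis
    unfolding ising_torus ising_def [of h L A] right_diff_distrib by linarith
qed

text \<open>\<open>f\<close> names the line in direction \<open>s\<close> through a site. On each
  line in \<open>Y\<close> one edge leaves \<open>S\<close> and one enters it; the former start
  inside \<open>S\<close> and the latter outside, so none is counted twice.\<close>

lemma card_bdry_ge:
  assumes "finite Y"
    and exits: "\<And>y. y \<in> Y \<Longrightarrow> \<exists>z\<in>torus L. f z = y \<and> z \<in> S \<and> s z \<notin> S"
    and enters: "\<And>y. y \<in> Y \<Longrightarrow> \<exists>z\<in>torus L. f z = y \<and> z \<notin> S \<and> s z \<in> S"
  shows "2 * card Y \<le> card (bdry L s S)"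
proof -
  obtain p where p: "\<And>y. y \<in> Y \<Longrightarrow> p y \<in> torus L \<and> f (p y) = y \<and> p y \<in> S \<and> s (p y) \<notin> S"
    using exits by metis
  obtain q where q: "\<And>y. y \<in> Y \<Longrightarrow> q y \<in> torus L \<and> f (q y) = y \<and> q y \<notin> S \<and> s (q y) \<in> S"
    using enters by metis
  have "inj_on p Y" "inj_on q Y"
    using inj_on_inverseI [of Y f p] inj_on_inverseI [of Y f q] p q by blast+
  then have "card (p ` Y) = card Y" "card (q ` Y) = card Y"
    by (simp_all add: card_image)
  moreover have "p ` Y \<subseteq> S" "q ` Y \<subseteq> - S"
    using p q by blast+
  then have "p ` Y \<inter> q ` Y = {}" by blast
  then have "card (p ` Y \<union> q ` Y) = card (p ` Y) + card (q ` Y)"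
    using assms(1) by (intro card_Un_disjoint) auto
  moreover have "card (p ` Y \<union> q ` Y) \<le> card (bdry L s S)"
    using p q by (intro card_mono) (auto simp: bdry_def)
  ultimately show ?thesis by linarith
qed

lemma cyclic_invariant:
  assumes "a < L" "P a" and step: "\<And>b. b < L \<Longrightarrow> P b \<Longrightarrow> P (Suc b mod L)"
  shows "c < L \<Longrightarrow> P c"
proof -
  have *: "P ((a + n) mod L)" for n
  proof (induction n)
    case (Suc n)
    then have "P (Suc ((a + n) mod L) mod L)" using assms(1) by (intro step) auto
    then show ?case by (simp add: mod_Suc_eq)
  qed (use assms in simp)
  assume "c < L"
  \<comment> \<open>The extra turn \<open>L\<close> avoids truncated subtraction when
    \<open>c < a\<close>.\<close>
  then have "(a + (c + L - a)) mod L = c" using assms(1) by simp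
  then show "P c" using * [of "c + L - a"] by simp
qed

lemma cyclic_exit:
  assumes "a < L" "P a" "c < L" "\<not> P c"
  shows "\<exists>b<L. P b \<and> \<not> P (Suc b mod L)"
  using cyclic_invariant [of a L P c] assms by blast

text \<open>Some column and some row miss \<open>S\<close> altogether. Hence no row or column is
  completely filled, and going around one that meets \<open>S\<close> means leaving and re-entering
  \<open>S\<close>.\<close>

lemma perim_ge:
  assumes S: "S \<subseteq> torus L" and "card (fst ` S) < L" "card (snd ` S) < L"
  shows "2 * (card (fst ` S) + card (snd ` S)) \<le> perim L S"
proof -
  have fin: "finite S" using S finite_torus finite_subset by blast
  have rows: "2 * card (snd ` S) \<le> card (bdry L (right L) S)"
  proof (rule card_bdry_ge [where f = snd])
    fix y assume "y \<in> snd ` S"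
    then obtain a where a: "(a, y) \<in> S" by auto
    have "\<exists>c<L. c \<notin> fst ` S"
      using assms(2) fin by (metis card_lessThan card_mono finite_imageI lessThan_iff linorder_not_le subsetI)
    then obtain c where c: "c < L" "(c, y) \<notin> S" by force
    have al: "a < L" "y < L" using a S by (auto simp: torus_def)
    show "\<exists>z\<in>torus L. snd z = y \<and> z \<in> S \<and> right L z \<notin> S"
      using cyclic_exit [of a L "\<lambda>u. (u, y) \<in> S" c] al a c by (force simp: torus_def right_def)
    show "\<exists>z\<in>torus L. snd z = y \<and> z \<notin> S \<and> right L z \<in> S"
      using cyclic_exit [of c L "\<lambda>u. (u, y) \<notin> S" a] al a c by (force simp: torus_def right_def)
  qed (use fin in simp)
  have cols: "2 * card (fst ` S) \<le> card (bdry L (up L) S)"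
  proof (rule card_bdry_ge [where f = fst])
    fix y assume "y \<in> fst ` S"
    then obtain a where a: "(y, a) \<in> S" by auto
    have "\<exists>c<L. c \<notin> snd ` S"
      using assms(3) fin by (metis card_lessThan card_mono finite_imageI lessThan_iff linorder_not_le subsetI)
    then obtain c where c: "c < L" "(y, c) \<notin> S" by force
    have al: "a < L" "y < L" using a S by (auto simp: torus_def)
    show "\<exists>z\<in>torus L. fst z = y \<and> z \<in> S \<and> up L z \<notin> S"
      using cyclic_exit [of a L "\<lambda>u. (y, u) \<in> S" c] al a c by (force simp: torus_def up_def)
    show "\<exists>z\<in>torus L. fst z = y \<and> z \<notin> S \<and> up L z \<in> S"
      using cyclic_exit [of c L "\<lambda>u. (y, u) \<notin> S" a] al a c by (force simp: torus_def up_def)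
  qed (use fin in simp)
  show ?thesis using rows cols by (simp add: perim_def)
qed

lemma card_le_fst_snd:
  assumes "finite S"
  shows "card S \<le> card (fst ` S) * card (snd ` S)"
proof -
  have "card S \<le> card (fst ` S \<times> snd ` S)"
    using assms by (intro card_mono) force+
  then show ?thesis by (simp add: card_cartesian_product)
qed

section \<open>Young diagrams and their growth site by site\<close>

definition young :: "(nat \<times> nat) set \<Rightarrow> bool" where
  "young R \<longleftrightarrow> (\<forall>(u, v)\<in>R. \<forall>u'\<le>u. \<forall>v'\<le>v. (u', v') \<in> R)"

text \<open>Each row is an initial segment, so its boundary edges are the one after its last site
  and the one wrapping from \<open>L - 1\<close> to \<open>0\<close>; \<open>a < L\<close> keeps
  \<open>L - 1\<close> outside \<open>R\<close>. Columns are alike.\<close>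

lemma perim_young_le:
  assumes "young R" and R: "R \<subseteq> {..<a} \<times> {..<b}" and "a < L" "b < L"
  shows "perim L R \<le> 2 * (a + b)"
proof -
  have fin: "finite R" using R finite_subset by blast
  let ?X = "{z\<in>R. (Suc (fst z), snd z) \<notin> R}" and ?Y = "{z\<in>R. (fst z, Suc (snd z)) \<notin> R}"
  have down: "(u', v') \<in> R" if "(u, v) \<in> R" "u' \<le> u" "v' \<le> v" for u v u' v'
    using assms(1) that by (auto simp: young_def)
  have cX: "card ?X \<le> b"
  proof -
    have "inj_on snd ?X"
    proof (rule inj_onI)
      fix z w assume zw: "z \<in> ?X" "w \<in> ?X" "snd z = snd w"
      have False if "fst z < fst w" using zw that down [of "fst w" "snd w" "Suc (fst z)" "snd z"] by auto
      moreover have False if "fst w < fst z" using zw(1,2) zw(3) [symmetric] that down [of "fst z" "snd z" "Suc (fst w)" "snd w"] by auto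
      ultimately show "z = w" using zw(3) by (metis linorder_neqE_nat prod_eqI)
    qed
    moreover have "snd ` ?X \<subseteq> {..<b}" using R by auto
    ultimately have "card ?X \<le> card {..<b}" by (rule card_inj_on_le) simp
    then show ?thesis by simp
  qed
  have cY: "card ?Y \<le> a"
  proof -
    have "inj_on fst ?Y"
    proof (rule inj_onI)
      fix z w assume zw: "z \<in> ?Y" "w \<in> ?Y" "fst z = fst w"
      have False if "snd z < snd w" using zw that down [of "fst w" "snd w" "fst z" "Suc (snd z)"] by auto
      moreover have False if "snd w < snd z" using zw(1,2) zw(3) [symmetric] that down [of "fst z" "snd z" "fst w" "Suc (snd w)"] by auto
      ultimately show "z = w" using zw(3) by (metis linorder_neqE_nat prod_eqI)
    qed
    moreover have "fst ` ?Y \<subseteq> {..<a}" using R by auto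
    ultimately have "card ?Y \<le> card {..<a}" by (rule card_inj_on_le) simp
    then show ?thesis by simp
  qed
  have "bdry L (right L) R \<subseteq> {L - 1} \<times> {..<b} \<union> ?X"
  proof
    fix z assume z: "z \<in> bdry L (right L) R"
    obtain u v where uv: "z = (u, v)" "u < L" "v < L" using z by (auto simp: bdry_def torus_def)
    show "z \<in> {L - 1} \<times> {..<b} \<union> ?X"
      using z uv R down [of "Suc u" v u v] assms(3)
      by (auto simp: bdry_def right_def Suc_mod_cases split: if_splits)
  qed
  then have "card (bdry L (right L) R) \<le> card ({L - 1} \<times> {..<b} \<union> ?X)"
    using fin by (intro card_mono) auto
  also have "\<dots> \<le> card ({L - 1} \<times> {..<b}) + card ?X" by (rule card_Un_le)
  finally have x: "card (bdry L (right L) R) \<le> 2 * b" using cX by simp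
  have "bdry L (up L) R \<subseteq> {..<a} \<times> {L - 1} \<union> ?Y"
  proof
    fix z assume z: "z \<in> bdry L (up L) R"
    obtain u v where uv: "z = (u, v)" "u < L" "v < L" using z by (auto simp: bdry_def torus_def)
    show "z \<in> {..<a} \<times> {L - 1} \<union> ?Y"
      using z uv R down [of u "Suc v" u v] assms(4)
      by (auto simp: bdry_def up_def Suc_mod_cases split: if_splits)
  qed
  then have "card (bdry L (up L) R) \<le> card ({..<a} \<times> {L - 1} \<union> ?Y)"
    using fin by (intro card_mono) auto
  also have "\<dots> \<le> card ({..<a} \<times> {L - 1}) + card ?Y" by (rule card_Un_le)
  finally have y: "card (bdry L (up L) R) \<le> 2 * a" using cY by (simp add: card_cartesian_product)
  show ?thesis using x y by (simp add: perim_def)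
qed

lemma young_rect: "young ({..<a} \<times> {..<b})"
  by (auto simp: young_def)

text \<open>A site of \<open>Y - W\<close> with least coordinate sum has all its predecessors in
  \<open>W\<close>, so adding it preserves the Young property.\<close>

lemma young_grow [consumes 4, case_names base step]:
  assumes "finite Y" "young X" "young Y" "X \<subseteq> Y"
    and base: "P X"
    and step: "\<And>W z. P W \<Longrightarrow> X \<subseteq> W \<Longrightarrow> z \<in> Y - W \<Longrightarrow> insert z W \<subseteq> Y \<Longrightarrow> young (insert z W) \<Longrightarrow> P (insert z W)"
  shows "P Y"
proof -
  have "P Y" if "young W" "X \<subseteq> W" "W \<subseteq> Y" "P W" for W
    using that
  proof (induction "card (Y - W)" arbitrary: W rule: less_induct)
    case less
    show ?case
    proof (cases "W = Y")
      case False
      then have "Y - W \<noteq> {}" using less.prems by blast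
      then obtain z where z: "z \<in> Y - W"
        and zmin: "\<And>w. w \<in> Y - W \<Longrightarrow> fst z + snd z \<le> fst w + snd w"
        using ex_has_least_nat [of "\<lambda>w. w \<in> Y - W" _ "\<lambda>w. fst w + snd w"] by blast
      have yW: "young (insert z W)"
        unfolding young_def
      proof clarify
        fix u v u' v' assume uv: "(u, v) \<in> insert z W" "u' \<le> u" "v' \<le> v" and n: "(u', v') \<notin> W"
        have zz: "z = (u, v)" using uv n less.prems(1) by (auto simp: young_def)
        then have "(u', v') \<in> Y" using uv z assms(3) by (auto simp: young_def)
        then have "u + v \<le> u' + v'" using zmin [of "(u', v')"] n zz by auto
        then show "(u', v') = z" using uv zz by auto
      qed
      have "card (Y - insert z W) < card (Y - W)"
        using z assms(1) by (intro psubset_card_mono) auto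
      then show ?thesis
        using less.hyps [of "insert z W"] yW z less.prems step [of W z] by auto
    qed (use less.prems in simp)
  qed
  then show ?thesis using assms by blast
qed

section \<open>Translations of the torus\<close>

definition translate :: "nat \<Rightarrow> nat \<times> nat \<Rightarrow> nat \<times> nat \<Rightarrow> nat \<times> nat" where
  "translate L x z = ((fst x + fst z) mod L, (snd x + snd z) mod L)"

lemma inj_on_add_mod: "inj_on (\<lambda>u. (x + u) mod L) {..<L::nat}"
proof (rule inj_onI)
  fix u v assume uv: "u \<in> {..<L}" "v \<in> {..<L}" "(x + u) mod L = (x + v) mod L"
  have *: "u = v" if "u \<le> v" "v < L" "(x + u) mod L = (x + v) mod L" for u v
  proof -
    have "L dvd v - u" using mod_eq_dvd_iff_nat [of "x + u" "x + v" L] that by simp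
    then show ?thesis using that by (metis diff_is_0_eq dvd_imp_le le_antisym less_imp_diff_less linorder_not_le not_gr_zero)
  qed
  consider "u \<le> v" | "v \<le> u" by linarith
  then show "u = v"
  proof cases
    case 1
    then show ?thesis using uv(2) by (rule * [OF _ _ uv(3), unfolded lessThan_iff [symmetric]])
  next
    case 2
    then have "v = u" using uv(1) by (rule * [OF _ _ uv(3) [symmetric], unfolded lessThan_iff [symmetric]])
    then show ?thesis by (rule sym)
  qed
qed

lemma inj_translate: "inj_on (translate L x) (torus L)"
proof (rule inj_onI)
  fix z w assume "z \<in> torus L" "w \<in> torus L" "translate L x z = translate L x w"
  then show "z = w"
    using inj_onD [OF inj_on_add_mod [of "fst x" L], of "fst z" "fst w"]
      inj_onD [OF inj_on_add_mod [of "snd x" L], of "snd z" "snd w"]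
    by (auto simp: translate_def torus_def prod_eq_iff)
qed

lemma translate_in_torus: "z \<in> torus L \<Longrightarrow> translate L x z \<in> torus L"
  by (auto simp: translate_def torus_def)

lemma bij_translate: "bij_betw (translate L x) (torus L) (torus L)"
proof -
  have "translate L x ` torus L = torus L"
    by (rule endo_inj_surj [OF finite_torus _ inj_translate]) (auto intro: translate_in_torus)
  then show ?thesis using inj_translate by (simp add: bij_betw_def)
qed

lemma translate_shift:
  "translate L x (right L z) = right L (translate L x z)"
  "translate L x (up L z) = up L (translate L x z)"
  by (simp_all add: translate_def right_def up_def mod_simps)

lemma card_bdry_translate:
  assumes R: "R \<subseteq> torus L"
    and s: "\<And>z. z \<in> torus L \<Longrightarrow> s z \<in> torus L" "\<And>z. translate L x (s z) = s (translate L x z)"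
  shows "card (bdry L s (translate L x ` R)) = card (bdry L s R)"
proof -
  have mem: "translate L x z \<in> translate L x ` R \<longleftrightarrow> z \<in> R" if "z \<in> torus L" for z
    using inj_translate R that by (metis inj_on_image_mem_iff)
  have "bdry L s (translate L x ` R) = translate L x ` bdry L s R" (is "?l = ?r")
  proof (rule set_eqI)
    fix w
    show "w \<in> ?l \<longleftrightarrow> w \<in> ?r"
    proof (cases "w \<in> torus L")
      case True
      then obtain z where z: "w = translate L x z" "z \<in> torus L"
        using bij_translate by (metis bij_betw_imp_surj_on imageE)
      have "w \<in> ?r \<longleftrightarrow> z \<in> bdry L s R"
        unfolding z(1) using inj_translate z(2) by (intro inj_on_image_mem_iff) (auto simp: bdry_def)
      also have "\<dots> \<longleftrightarrow> w \<in> ?l"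
        using z mem [of z] mem [of "s z"] s by (simp add: bdry_def translate_in_torus)
      finally show ?thesis by blast
    next
      case False
      then show ?thesis by (auto simp: bdry_def translate_in_torus)
    qed
  qed
  then show ?thesis
    using inj_on_subset [OF inj_translate, of "bdry L s R"] by (simp add: card_image bdry_def subset_iff)
qed

lemma ising_translate:
  assumes "R \<subseteq> torus L"
  shows "ising h L (translate L x ` R) = ising h L R"
proof -
  have "card (translate L x ` R) = card R"
    using inj_on_subset [OF inj_translate assms] by (rule card_image)
  then show ?thesis
    using assms by (simp add: ising_def perim_def card_bdry_translate translate_shift shifts_in_torus)
qed

subsection \<open>Transitions as pairs of Ising configurations\<close>

lemma configs_val: "\<sigma> \<in> configs L \<Longrightarrow> i \<in> torus L \<Longrightarrow> \<sigma> i = -1 \<or> \<sigma> i = 1"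
  by (auto simp: configs_def PiE_iff)

text \<open>With \<open>w\<close> the local field at \<open>i\<close>, the penalty there is
  \<open>|w| - \<eta> i * w\<close>. The absolute values cancel those in \<open>energy\<close>,
  leaving an expression affine in \<eta>.\<close>

lemma trans_energy_eq:
  assumes "\<eta> \<in> configs L"
  shows "trans_energy h L \<sigma> \<eta> = - h * (\<Sum>i\<in>torus L. \<sigma> i) - (\<Sum>i\<in>torus L. \<eta> i * (nbsum L \<sigma> i + h))"
proof -
  let ?w = "\<lambda>i. nbsum L \<sigma> i + h"
  have "cost h L \<sigma> \<eta> = (\<Sum>i\<in>torus L. if \<eta> i * ?w i < 0 then 2 * \<bar>?w i\<bar> else 0)"
    by (simp add: cost_eq [OF assms] sum.inter_filter)
  also have "\<dots> = (\<Sum>i\<in>torus L. \<bar>?w i\<bar> - \<eta> i * ?w i)"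
  proof (rule sum.cong)
    fix i assume "i \<in> torus L"
    then consider "\<eta> i = -1" | "\<eta> i = 1" using configs_val [OF assms] by blast
    then show "(if \<eta> i * ?w i < 0 then 2 * \<bar>?w i\<bar> else 0) = \<bar>?w i\<bar> - \<eta> i * ?w i"
      by cases (auto simp: abs_if)
  qed simp
  finally show ?thesis by (simp add: trans_energy_def energy_def sum_subtractf)
qed

text \<open>The zero-temperature update, which costs nothing. Pairing \<sigma> with it writes the
  energy of one configuration as a transition energy, hence as a sum over two layers.\<close>

definition relax :: "real \<Rightarrow> nat \<Rightarrow> config \<Rightarrow> config" where
  "relax h L \<sigma> = (\<lambda>i\<in>torus L. if nbsum L \<sigma> i + h \<ge> 0 then 1 else -1)"

lemma relax_in_configs [simp]: "relax h L \<sigma> \<in> configs L"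
  by (auto simp: relax_def configs_def)

lemma trans_energy_relax: "trans_energy h L \<sigma> (relax h L \<sigma>) = energy h L \<sigma>"
  unfolding trans_energy_eq [OF relax_in_configs] energy_def
  by (auto simp: relax_def intro!: sum.cong)

lemma energy_le_trans_energy:
  assumes "\<eta> \<in> configs L"
  shows "energy h L \<sigma> \<le> trans_energy h L \<sigma> \<eta>"
proof -
  have "(\<Sum>i\<in>torus L. \<eta> i * (nbsum L \<sigma> i + h)) \<le> (\<Sum>i\<in>torus L. \<bar>nbsum L \<sigma> i + h\<bar>)"
    using configs_val [OF assms] by (intro sum_mono) (force simp: abs_if)
  then show ?thesis by (simp add: trans_energy_eq [OF assms] energy_def)
qed

text \<open>The edges of the torus join sites of opposite parity. Hence in
  \<open>trans_energy h L \<sigma> \<eta>\<close> the even spins of \<open>\<sigma>\<close> interact only with the odd spins of \<open>\<eta>\<close>, and vice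
  versa: one transition carries two independent Ising configurations, \<open>layer L \<sigma> \<eta>\<close> and
  \<open>layer L \<eta> \<sigma>\<close>.\<close>

definition layer :: "nat \<Rightarrow> config \<Rightarrow> config \<Rightarrow> (nat \<times> nat) set" where
  "layer L \<sigma> \<eta> = {i \<in> torus L. (if even (fst i + snd i) then \<sigma> i else \<eta> i) = 1}"

definition spin :: "(nat \<times> nat) set \<Rightarrow> nat \<times> nat \<Rightarrow> real" where
  "spin A i = (if i \<in> A then 1 else -1)"

text \<open>Inverse to taking layers: for subsets of the torus, the transition from
  \<open>interleave L A B\<close> to \<open>interleave L B A\<close> has layers \<open>A\<close> and
  \<open>B\<close>.\<close>

definition interleave :: "nat \<Rightarrow> (nat \<times> nat) set \<Rightarrow> (nat \<times> nat) set \<Rightarrow> config" where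
  "interleave L A B = (\<lambda>i\<in>torus L. if even (fst i + snd i) then spin A i else spin B i)"

lemma layer_subset: "layer L \<sigma> \<eta> \<subseteq> torus L"
  by (auto simp: layer_def)

lemma finite_layer [simp]: "finite (layer L \<sigma> \<eta>)"
  by (rule finite_subset [OF layer_subset finite_torus])

lemma interleave_in_configs [simp]: "interleave L A B \<in> configs L"
  by (auto simp: interleave_def spin_def configs_def)

lemma layer_interleave:
  assumes "A \<subseteq> torus L"
  shows "layer L (interleave L A B) (interleave L B A) = A"
proof (rule set_eqI)
  fix i
  show "i \<in> layer L (interleave L A B) (interleave L B A) \<longleftrightarrow> i \<in> A"
    using assms by (cases "i \<in> torus L") (auto simp add: layer_def interleave_def spin_def)
qed

lemma interleave_layer:
  assumes "\<sigma> \<in> configs L" "\<eta> \<in> configs L"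
  shows "interleave L (layer L \<sigma> \<eta>) (layer L \<eta> \<sigma>) = \<sigma>"
proof (rule ext)
  fix i
  show "interleave L (layer L \<sigma> \<eta>) (layer L \<eta> \<sigma>) i = \<sigma> i"
  proof (cases "i \<in> torus L")
    case True
    then consider "\<sigma> i = -1" | "\<sigma> i = 1" using configs_val [OF assms(1)] by blast
    then show ?thesis using True by cases (simp_all add: interleave_def spin_def layer_def)
  next
    case False
    with assms(1) have "\<sigma> i = undefined" unfolding configs_def by (rule PiE_arb)
    then show ?thesis using False by (simp add: interleave_def)
  qed
qed

text \<open>Because \<open>L\<close> is even, parity alternates across the wrap-around edges
  too.\<close>

lemma even_shift:
  assumes "even L" "i \<in> torus L"
  shows "even (fst (right L i) + snd (right L i)) \<longleftrightarrow> odd (fst i + snd i)"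
    and "even (fst (up L i) + snd (up L i)) \<longleftrightarrow> odd (fst i + snd i)"
proof -
  have "even (Suc a mod L) \<longleftrightarrow> odd a" if "a < L" for a
    using assms(1) that by (cases "Suc a = L") auto
  then show "even (fst (right L i) + snd (right L i)) \<longleftrightarrow> odd (fst i + snd i)"
    "even (fst (up L i) + snd (up L i)) \<longleftrightarrow> odd (fst i + snd i)"
    using assms(2) by (auto simp: right_def up_def torus_def)
qed

lemma sum_spin:
  assumes "A \<subseteq> torus L"
  shows "(\<Sum>i\<in>torus L. spin A i) = 2 * real (card A) - real (L * L)"
proof -
  have "(\<Sum>i\<in>torus L. spin A i) = (\<Sum>i\<in>torus L. 2 * of_bool (i \<in> A) - 1)"
    by (intro sum.cong) (auto simp: spin_def)
  also have "\<dots> = 2 * (\<Sum>i\<in>torus L. of_bool (i \<in> A)) - real (card (torus L))"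
    by (simp only: sum_subtractf sum_distrib_left [symmetric] sum_constant mult_1_right)
  also have "(\<Sum>i\<in>torus L. of_bool (i \<in> A)) = real (card A)"
    using assms by (simp add: Int_absorb1)
  finally show ?thesis by (simp only: card_torus)
qed

lemma sum_spin_shift:
  "(\<Sum>i\<in>torus L. spin A i * spin A (s i)) = real (L * L) - 2 * real (card (bdry L s A))"
proof -
  have "(\<Sum>i\<in>torus L. spin A i * spin A (s i))
      = (\<Sum>i\<in>torus L. 1 - 2 * of_bool ((i \<in> A) \<noteq> (s i \<in> A)))"
    by (intro sum.cong) (auto simp: spin_def)
  also have "\<dots> = real (card (torus L)) - 2 * (\<Sum>i\<in>torus L. of_bool ((i \<in> A) \<noteq> (s i \<in> A)))"
    by (simp only: sum_subtractf sum_distrib_left [symmetric] sum_constant mult_1_right)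
  finally show ?thesis by (simp only: sum_bdry card_torus)
qed

text \<open>After reindexing left and down neighbours, each edge carries two products of a spin of
  \<sigma> with one of \<eta>. Its ends have opposite parity, so one product falls into each layer.
  The constant is the Ising energy of two all-minus layers.\<close>

lemma trans_energy_layer:
  assumes \<sigma>: "\<sigma> \<in> configs L" and \<eta>: "\<eta> \<in> configs L" and L: "even L" "3 \<le> L"
  shows "trans_energy h L \<sigma> \<eta>
    = 2 * (h - 2) * real (L * L) + ising h L (layer L \<sigma> \<eta>) + ising h L (layer L \<eta> \<sigma>)"
proof -
  let ?T = "torus L" and ?A = "layer L \<sigma> \<eta>" and ?B = "layer L \<eta> \<sigma>"
  have val: "\<sigma> i = (if even (fst i + snd i) then spin ?A i else spin ?B i)"
    "\<eta> i = (if even (fst i + snd i) then spin ?B i else spin ?A i)" if "i \<in> ?T" for i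
    using that configs_val [OF \<sigma> that] configs_val [OF \<eta> that] by (auto simp: spin_def layer_def)
  have s: "(\<Sum>i\<in>?T. \<eta> i * \<sigma> (s i) + \<eta> (s i) * \<sigma> i)
      = 2 * real (L * L) - 2 * real (card (bdry L s ?A)) - 2 * real (card (bdry L s ?B))"
    if s: "\<And>i. i \<in> ?T \<Longrightarrow> s i \<in> ?T" "\<And>i. i \<in> ?T \<Longrightarrow> even (fst (s i) + snd (s i)) \<longleftrightarrow> odd (fst i + snd i)" for s
  proof -
    have "(\<Sum>i\<in>?T. \<eta> i * \<sigma> (s i) + \<eta> (s i) * \<sigma> i)
        = (\<Sum>i\<in>?T. spin ?A i * spin ?A (s i) + spin ?B i * spin ?B (s i))"
    proof (rule sum.cong)
      fix i assume i: "i \<in> ?T"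
      show "\<eta> i * \<sigma> (s i) + \<eta> (s i) * \<sigma> i = spin ?A i * spin ?A (s i) + spin ?B i * spin ?B (s i)"
        unfolding val [OF i] val [OF s(1) [OF i]] s(2) [OF i] by simp
    qed simp
    then show ?thesis by (simp only: sum.distrib sum_spin_shift)
  qed
  have l: "(\<Sum>i\<in>?T. \<eta> i * \<sigma> (left L i)) = (\<Sum>i\<in>?T. \<eta> (right L i) * \<sigma> i)"
    by (subst sum.reindex_bij_betw [OF bij_right, symmetric]) (simp add: left_right)
  have d: "(\<Sum>i\<in>?T. \<eta> i * \<sigma> (down L i)) = (\<Sum>i\<in>?T. \<eta> (up L i) * \<sigma> i)"
    by (subst sum.reindex_bij_betw [OF bij_up, symmetric]) (simp add: down_up)
  have "(\<Sum>i\<in>?T. \<eta> i * nbsum L \<sigma> i)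
      = (\<Sum>i\<in>?T. \<eta> i * \<sigma> (right L i) + \<eta> i * \<sigma> (left L i) + \<eta> i * \<sigma> (up L i) + \<eta> i * \<sigma> (down L i))"
    using L(2) by (intro sum.cong) (simp_all add: nbsum_eq algebra_simps)
  also have "\<dots> = (\<Sum>i\<in>?T. \<eta> i * \<sigma> (right L i) + \<eta> (right L i) * \<sigma> i)
      + (\<Sum>i\<in>?T. \<eta> i * \<sigma> (up L i) + \<eta> (up L i) * \<sigma> i)"
    by (simp add: sum.distrib l d)
  also have "\<dots> = 4 * real (L * L) - 2 * real (perim L ?A) - 2 * real (perim L ?B)"
    using s [of "right L"] s [of "up L"] even_shift [OF L(1)] shifts_in_torus [of _ L]
    by (simp add: perim_def)
  finally have nb: "(\<Sum>i\<in>?T. \<eta> i * nbsum L \<sigma> i) = \<dots>" .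
  have "(\<Sum>i\<in>?T. \<sigma> i) + (\<Sum>i\<in>?T. \<eta> i) = (\<Sum>i\<in>?T. spin ?A i) + (\<Sum>i\<in>?T. spin ?B i)"
    unfolding sum.distrib [symmetric] by (rule sum.cong) (simp_all add: val)
  then have m: "(\<Sum>i\<in>?T. \<sigma> i) + (\<Sum>i\<in>?T. \<eta> i) = 2 * real (card ?A) + 2 * real (card ?B) - 2 * real (L * L)"
    by (simp only: sum_spin [OF layer_subset])
  have "trans_energy h L \<sigma> \<eta>
      = - h * ((\<Sum>i\<in>?T. \<sigma> i) + (\<Sum>i\<in>?T. \<eta> i)) - (\<Sum>i\<in>?T. \<eta> i * nbsum L \<sigma> i)"
    by (simp add: trans_energy_eq [OF \<eta>] distrib_left sum.distrib sum_distrib_right [symmetric])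
  then show ?thesis
    unfolding m nb ising_def by (simp add: algebra_simps)
qed

lemma trans_energy_commute:
  assumes "\<sigma> \<in> configs L" "\<eta> \<in> configs L" "even L" "3 \<le> L"
  shows "trans_energy h L \<sigma> \<eta> = trans_energy h L \<eta> \<sigma>"
  using assms by (simp add: trans_energy_layer)

subsection \<open>Stability levels\<close>

text \<open>Paths with at least one transition. The last transition is remembered so that it can be
  traversed backwards, and a set \<open>U\<close> of allowed transition energies covers weak and
  strict bounds alike.\<close>

inductive reach :: "real \<Rightarrow> nat \<Rightarrow> real set \<Rightarrow> config \<Rightarrow> config \<Rightarrow> config \<Rightarrow> bool"
  for h L U \<sigma> where
  start: "\<eta> \<in> configs L \<Longrightarrow> trans_energy h L \<sigma> \<eta> \<in> U \<Longrightarrow> reach h L U \<sigma> \<sigma> \<eta>"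
| step: "reach h L U \<sigma> \<xi> \<eta> \<Longrightarrow> \<zeta> \<in> configs L \<Longrightarrow> trans_energy h L \<eta> \<zeta> \<in> U \<Longrightarrow> reach h L U \<sigma> \<eta> \<zeta>"

lemma reach_last: "reach h L U \<sigma> \<xi> \<eta> \<Longrightarrow> trans_energy h L \<xi> \<eta> \<in> U"
  by (erule reach.cases) auto

lemma reach_path:
  assumes "reach h L U \<sigma> \<xi> \<eta>" "\<sigma> \<in> configs L"
  shows "\<exists>\<omega>\<in>paths L \<sigma> \<eta>. 1 < length \<omega> \<and>
    (\<forall>k. Suc k < length \<omega> \<longrightarrow> trans_energy h L (\<omega> ! k) (\<omega> ! Suc k) \<in> U)"
  using assms(1)
proof induction
  case (start \<eta>)
  then show ?case using assms(2) by (intro bexI [of _ "[\<sigma>, \<eta>]"]) (auto simp: paths_def)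
next
  case (step \<xi> \<eta> \<zeta>)
  then obtain \<omega> where \<omega>: "\<omega> \<in> paths L \<sigma> \<eta>" "1 < length \<omega>"
    and U: "\<And>k. Suc k < length \<omega> \<Longrightarrow> trans_energy h L (\<omega> ! k) (\<omega> ! Suc k) \<in> U" by blast
  have ne: "\<omega> \<noteq> []" and last: "last \<omega> = \<eta>" using \<omega>(1) by (auto simp: paths_def)
  show ?case
  proof (intro bexI [of _ "\<omega> @ [\<zeta>]"] conjI allI impI)
    show "\<omega> @ [\<zeta>] \<in> paths L \<sigma> \<zeta>" using \<omega>(1) step.hyps by (auto simp: paths_def)
    show "1 < length (\<omega> @ [\<zeta>])" using \<omega>(2) ne by simp
    fix k assume k: "Suc k < length (\<omega> @ [\<zeta>])"
    show "trans_energy h L ((\<omega> @ [\<zeta>]) ! k) ((\<omega> @ [\<zeta>]) ! Suc k) \<in> U"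
    proof (cases "Suc k < length \<omega>")
      case True
      then show ?thesis using U by (simp add: nth_append)
    next
      case False
      then have "k = length \<omega> - 1" "Suc k = length \<omega>" using k by simp_all
      then have "(\<omega> @ [\<zeta>]) ! k = \<eta>" "(\<omega> @ [\<zeta>]) ! Suc k = \<zeta>"
        using last ne last_conv_nth [of \<omega>] by (auto simp: nth_append)
      then show ?thesis using step.hyps by simp
    qed
  qed
qed

lemma finite_lower [simp]: "finite (lower h L \<sigma>)"
  by (simp add: lower_def)

lemma comm_height_set_singleton:
  "comm_height_set h L {\<sigma>} B = Min ((\<lambda>\<eta>. comm_height h L \<sigma> \<eta>) ` B)"
proof -
  have "{comm_height h L \<sigma>' \<eta> | \<sigma>' \<eta>. \<sigma>' \<in> {\<sigma>} \<and> \<eta> \<in> B} = (\<lambda>\<eta>. comm_height h L \<sigma> \<eta>) ` B" by auto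
  then show ?thesis by (simp add: comm_height_set_def)
qed

text \<open>The maximum along the path is attained, so the height itself lies in \<open>U\<close>;
  an open half-line thus yields a strict bound.\<close>

lemma stab_level_le:
  assumes r: "reach h L U \<sigma> \<xi> \<eta>" and \<sigma>: "\<sigma> \<in> configs L" and \<eta>: "\<eta> \<in> configs L" "energy h L \<eta> < energy h L \<sigma>"
  shows "\<exists>u\<in>U. stab_level h L \<sigma> \<le> ereal (u - energy h L \<sigma>)"
proof -
  obtain \<omega> where \<omega>: "\<omega> \<in> paths L \<sigma> \<eta>" "1 < length \<omega>"
    and U: "\<And>k. Suc k < length \<omega> \<Longrightarrow> trans_energy h L (\<omega> ! k) (\<omega> ! Suc k) \<in> U"
    using reach_path [OF r \<sigma>] by blast
  have ne: "0 \<in> {k. Suc k < length \<omega>}" using \<omega>(2) by simp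
  let ?S = "{trans_energy h L (\<omega> ! k) (\<omega> ! Suc k) | k. Suc k < length \<omega>}"
  have S: "?S = (\<lambda>k. trans_energy h L (\<omega> ! k) (\<omega> ! Suc k)) ` {k. Suc k < length \<omega>}" by auto
  have "finite {k. Suc k < length \<omega>}" by (rule finite_subset [of _ "{..<length \<omega>}"]) auto
  then have "Max ?S \<in> ?S" using ne unfolding S by (intro Max_in finite_imageI) blast+
  then have hU: "height h L \<omega> \<in> U" using U \<omega>(2) by (auto simp: height_def)
  have l: "\<eta> \<in> lower h L \<sigma>" using \<eta> by (simp add: lower_def)
  have "comm_height_set h L {\<sigma>} (lower h L \<sigma>) \<le> comm_height h L \<sigma> \<eta>"
    using l by (simp add: comm_height_set_singleton)
  also have "\<dots> \<le> height h L \<omega>"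
    unfolding comm_height_def using \<omega>(1) by (intro Min_le finite_heights) simp
  finally have "stab_level h L \<sigma> \<le> ereal (height h L \<omega> - energy h L \<sigma>)"
    using l by (auto simp: stab_level_def)
  then show ?thesis using hU by blast
qed

lemma stab_level_ge:
  assumes \<sigma>: "\<sigma> \<in> configs L"
    and M: "\<And>\<eta> \<omega>. \<eta> \<in> lower h L \<sigma> \<Longrightarrow> \<omega> \<in> paths L \<sigma> \<eta> \<Longrightarrow> M \<le> height h L \<omega>"
  shows "ereal (M - energy h L \<sigma>) \<le> stab_level h L \<sigma>"
proof (cases "lower h L \<sigma> = {}")
  case False
  have "M \<le> comm_height h L \<sigma> \<eta>" if \<eta>: "\<eta> \<in> lower h L \<sigma>" for \<eta>
  proof -
    have "paths L \<sigma> \<eta> \<noteq> {}" using \<sigma> \<eta> by (intro paths_nonempty) (auto simp: lower_def)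
    then have "comm_height h L \<sigma> \<eta> \<in> height h L ` paths L \<sigma> \<eta>"
      unfolding comm_height_def by (intro Min_in finite_heights) simp
    then show ?thesis using M [OF \<eta>] by auto
  qed
  then have "M \<le> comm_height_set h L {\<sigma>} (lower h L \<sigma>)"
    using False by (simp add: comm_height_set_singleton)
  then show ?thesis using False by (simp add: stab_level_def)
qed (simp add: stab_level_def)

text \<open>For fixed \<open>\<xi>\<close>, \<open>trans_energy h L \<xi> \<eta>\<close> is affine in each spin of \<open>\<eta>\<close>, so that a parallel
  update splits into single spin flips, those lowering the energy first, without exceeding the
  energies of its two ends.\<close>

lemma parallel_update_invariant:
  assumes \<xi>: "\<xi> \<in> configs L" and \<zeta>: "\<zeta> \<in> configs L" "trans_energy h L \<xi> \<zeta> < M"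
    and flip: "\<And>\<eta> x a. \<lbrakk>\<eta> \<in> configs L; x \<in> torus L; \<eta>(x := a) \<in> configs L; G \<xi> \<eta>;
        trans_energy h L \<xi> (\<eta>(x := a)) < M\<rbrakk> \<Longrightarrow> G \<xi> (\<eta>(x := a))"
  shows "\<eta> \<in> configs L \<Longrightarrow> trans_energy h L \<xi> \<eta> < M \<Longrightarrow> G \<xi> \<eta> \<Longrightarrow> G \<xi> \<zeta>"
proof (induction "card {i \<in> torus L. \<eta> i \<noteq> \<zeta> i}" arbitrary: \<eta> rule: less_induct)
  case less
  note \<eta> = less.prems(1)
  let ?w = "\<lambda>i. nbsum L \<xi> i + h" and ?D = "\<lambda>\<eta>. {i \<in> torus L. \<eta> i \<noteq> \<zeta> i}"
  have diff: "trans_energy h L \<xi> \<eta>' - trans_energy h L \<xi> \<eta> = (\<Sum>i\<in>torus L. (\<eta> i - \<eta>' i) * ?w i)"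
    if "\<eta>' \<in> configs L" for \<eta>'
    unfolding trans_energy_eq [OF that] trans_energy_eq [OF \<eta>] left_diff_distrib sum_subtractf by simp
  show ?case
  proof (cases "?D \<eta> = {}")
    case True
    then have "\<eta> = \<zeta>"
      using \<eta> \<zeta>(1) by (intro PiE_ext [of \<eta> "torus L" _ \<zeta>]) (auto simp: configs_def)
    then show ?thesis using less.prems by simp
  next
    case False
    have conf: "\<eta>(x := \<zeta> x) \<in> configs L" if "x \<in> torus L" for x
      using that \<eta> \<zeta>(1) by (auto simp: configs_def PiE_iff extensional_def)
    have single: "trans_energy h L \<xi> (\<eta>(x := \<zeta> x)) - trans_energy h L \<xi> \<eta> = (\<eta> x - \<zeta> x) * ?w x"
      if "x \<in> torus L" for x
    proof -
      have "(\<Sum>i\<in>torus L. (\<eta> i - (\<eta>(x := \<zeta> x)) i) * ?w i)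
          = (\<Sum>i\<in>torus L. if i = x then (\<eta> x - \<zeta> x) * ?w x else 0)"
        by (intro sum.cong) auto
      then show ?thesis using that by (simp add: diff [OF conf [OF that]])
    qed
    have "\<exists>x\<in>?D \<eta>. trans_energy h L \<xi> (\<eta>(x := \<zeta> x)) < M"
    proof (cases "\<exists>x\<in>?D \<eta>. (\<eta> x - \<zeta> x) * ?w x \<le> 0")
      case True
      then obtain x where "x \<in> ?D \<eta>" "(\<eta> x - \<zeta> x) * ?w x \<le> 0" by blast
      then show ?thesis using single [of x] less.prems(2) by (intro bexI [of _ x]) auto
    next
      \<comment> \<open>If every remaining flip raises the energy, the increments add up to the
        total difference, so a single flip stays at or below the energy at \<zeta>.\<close>
      case pos: False
      obtain x where x: "x \<in> ?D \<eta>" using False by blast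
      have nonneg: "0 \<le> (\<eta> i - \<zeta> i) * ?w i" if "i \<in> torus L" for i
      proof (cases "\<eta> i = \<zeta> i")
        case False
        then have "\<not> (\<eta> i - \<zeta> i) * ?w i \<le> 0" using pos that by blast
        then show ?thesis by linarith
      qed simp
      have "(\<eta> x - \<zeta> x) * ?w x \<le> (\<Sum>i\<in>torus L. (\<eta> i - \<zeta> i) * ?w i)"
        using x nonneg by (intro member_le_sum) auto
      then show ?thesis
        using single [of x] x \<zeta>(2) diff [OF \<zeta>(1)] by (intro bexI [of _ x]) auto
    qed
    then obtain x where x: "x \<in> ?D \<eta>" "trans_energy h L \<xi> (\<eta>(x := \<zeta> x)) < M" by blast
    have "?D (\<eta>(x := \<zeta> x)) \<subset> ?D \<eta>" using x(1) by auto
    then have "card (?D (\<eta>(x := \<zeta> x))) < card (?D \<eta>)" by (intro psubset_card_mono) auto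
    moreover have "G \<xi> (\<eta>(x := \<zeta> x))"
      using x conf [of x] \<eta> less.prems(3) by (intro flip) auto
    ultimately show ?thesis using less.hyps [of "\<eta>(x := \<zeta> x)"] x conf [of x] by blast
  qed
qed

text \<open>\<open>G\<close> is attached to transitions, and \<open>flip\<close> changes only the
  target. Reversing the transition from \<open>\<omega> ! k\<close> to
  \<open>\<omega> ! Suc k\<close> makes \<open>\<omega> ! k\<close> the target, which is then moved
  to \<open>\<omega> ! Suc (Suc k)\<close>. The free transitions to \<open>relax\<close> supply the
  start and the end.\<close>

lemma path_invariant:
  assumes L: "even L" "3 \<le> L" and \<sigma>: "\<sigma> \<in> configs L" "energy h L \<sigma> < M" "G \<sigma> (relax h L \<sigma>)"
    and sym: "\<And>\<xi> \<eta>. G \<xi> \<eta> \<Longrightarrow> G \<eta> \<xi>"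
    and flip: "\<And>\<xi> \<eta> x a. \<lbrakk>\<xi> \<in> configs L; \<eta> \<in> configs L; x \<in> torus L; \<eta>(x := a) \<in> configs L; G \<xi> \<eta>;
        trans_energy h L \<xi> (\<eta>(x := a)) < M\<rbrakk> \<Longrightarrow> G \<xi> (\<eta>(x := a))"
    and \<omega>: "\<omega> \<in> paths L \<sigma> \<eta>" "height h L \<omega> < M" and \<eta>: "energy h L \<eta> < M"
  shows "G \<eta> (relax h L \<eta>)"
proof -
  have update: "G \<xi> \<zeta>" if "\<xi> \<in> configs L" "\<eta> \<in> configs L" "\<zeta> \<in> configs L" "G \<xi> \<eta>"
    "trans_energy h L \<xi> \<eta> < M" "trans_energy h L \<xi> \<zeta> < M" for \<xi> \<eta> \<zeta>
    using parallel_update_invariant [of \<xi> L \<zeta> h M G \<eta>] flip that by blast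
  have ne: "\<omega> \<noteq> []" and hd: "\<omega> ! 0 = \<sigma>" and last: "\<omega> ! (length \<omega> - 1) = \<eta>"
    using \<omega>(1) by (auto simp: paths_def hd_conv_nth last_conv_nth)
  have conf: "\<omega> ! k \<in> configs L" if "k < length \<omega>" for k
    using that \<omega>(1) by (auto simp: paths_def)
  show ?thesis
  proof (cases "length \<omega> = 1")
    case True
    then show ?thesis using hd last \<sigma>(3) by simp
  next
    case False
    then have len: "1 < length \<omega>" using ne by (cases \<omega>) auto
    let ?S = "{trans_energy h L (\<omega> ! k) (\<omega> ! Suc k) | k. Suc k < length \<omega>}"
    have S: "?S = (\<lambda>k. trans_energy h L (\<omega> ! k) (\<omega> ! Suc k)) ` {k. Suc k < length \<omega>}" by auto
    have "finite {k. Suc k < length \<omega>}" by (rule finite_subset [of _ "{..<length \<omega>}"]) auto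
    then have fin: "finite ?S" unfolding S by simp
    have tr: "trans_energy h L (\<omega> ! k) (\<omega> ! Suc k) < M" if "Suc k < length \<omega>" for k
    proof -
      have "trans_energy h L (\<omega> ! k) (\<omega> ! Suc k) \<le> Max ?S" using fin that by (intro Max_ge) auto
      then show ?thesis using \<omega>(2) False by (simp add: height_def)
    qed
    have inv: "Suc k < length \<omega> \<Longrightarrow> G (\<omega> ! k) (\<omega> ! Suc k)" for k
    proof (induction k)
      case 0
      then show ?case
        using update [of \<sigma> "relax h L \<sigma>" "\<omega> ! 1"] \<sigma> conf [of 1] tr [of 0] hd by (simp add: trans_energy_relax)
    next
      case (Suc k)
      have "trans_energy h L (\<omega> ! Suc k) (\<omega> ! k) < M"
        using tr [of k] Suc.prems conf L by (subst trans_energy_commute) auto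
      then show ?case
        using update [of "\<omega> ! Suc k" "\<omega> ! k" "\<omega> ! Suc (Suc k)"] Suc conf tr [of "Suc k"] sym by simp
    qed
    let ?k = "length \<omega> - 2"
    have k: "Suc ?k = length \<omega> - 1" "Suc ?k < length \<omega>" using len by auto
    have "trans_energy h L \<eta> (\<omega> ! ?k) < M"
      using tr [OF k(2)] k last conf by (subst trans_energy_commute) (auto simp: L)
    then show ?thesis
      using update [of \<eta> "\<omega> ! ?k" "relax h L \<eta>"] inv [OF k(2)] k last conf [of ?k] conf [of "length \<omega> - 1"] sym \<eta>
      by (simp add: trans_energy_relax)
  qed
qed

section \<open>Realizing the growth of a layer by transitions\<close>

lemma reach_interleave_swap:
  assumes "reach h L U \<sigma> (interleave L A B) (interleave L B A)" "even L" "3 \<le> L"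
  shows "reach h L U \<sigma> (interleave L B A) (interleave L A B)"
  using assms reach_last [OF assms(1)] trans_energy_commute [of "interleave L B A" L "interleave L A B" h]
  by (intro reach.step [OF assms(1)]) auto

lemma trans_energy_interleave:
  assumes "A \<subseteq> torus L" "B \<subseteq> torus L" "even L" "3 \<le> L"
  shows "trans_energy h L (interleave L A B) (interleave L B A)
    = 2 * (h - 2) * real (L * L) + ising h L A + ising h L B"
  using assms by (simp add: trans_energy_layer layer_interleave)

text \<open>The new site occurs in only one end of the transition, depending on its parity. The path
  is first brought to the other end, if necessary by going back over the last transition, and then
  steps to the changed one.\<close>

lemma reach_insert:
  assumes r: "reach h L U \<sigma> (interleave L A B) (interleave L B A)" and L: "even L" "3 \<le> L"
    and AB: "A \<subseteq> torus L" "B \<subseteq> torus L" and z: "z \<in> torus L"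
    and U: "2 * (h - 2) * real (L * L) + ising h L (insert z A) + ising h L B \<in> U"
  shows "reach h L U \<sigma> (interleave L (insert z A) B) (interleave L B (insert z A))"
proof (cases "even (fst z + snd z)")
  case True
  then have "spin (insert z A) i = spin A i" if "odd (fst i + snd i)" for i
    using that by (auto simp: spin_def)
  then have eq: "interleave L B (insert z A) = interleave L B A"
    unfolding interleave_def by (intro restrict_ext) simp
  have "reach h L U \<sigma> (interleave L B (insert z A)) (interleave L (insert z A) B)"
    unfolding eq
  proof (rule reach.step [OF r])
    show "trans_energy h L (interleave L B A) (interleave L (insert z A) B) \<in> U"
      unfolding eq [symmetric] using U AB z L trans_energy_interleave [of B L "insert z A"] by (simp add: ac_simps)
  qed simp
  then show ?thesis using L by (rule reach_interleave_swap)
next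
  case False
  then have "spin (insert z A) i = spin A i" if "even (fst i + snd i)" for i
    using that by (auto simp: spin_def)
  then have eq: "interleave L (insert z A) B = interleave L A B"
    unfolding interleave_def by (intro restrict_ext) simp
  have "trans_energy h L (interleave L A B) (interleave L B (insert z A)) \<in> U"
    unfolding eq [symmetric] using U AB z L trans_energy_interleave [of "insert z A" L B] by simp
  then show ?thesis
    unfolding eq using reach.step [OF reach_interleave_swap [OF r L]] by simp
qed

subsection \<open>Critical droplets\<close>

lemma ising_ge:
  assumes "S \<subseteq> torus L" "card (fst ` S) < L" "card (snd ` S) < L"
  shows "2 * (2 * (real (card (fst ` S)) + real (card (snd ` S))) - h * real (card S)) \<le> ising h L S"
proof -
  have "2 * (real (card (fst ` S)) + real (card (snd ` S))) \<le> real (perim L S)"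
    using of_nat_mono [OF perim_ge [OF assms], where ?'a = real] by simp
  then show ?thesis by (simp add: ising_def)
qed

lemma four_mult_le_square: "4 * (r * c) \<le> (r + c)\<^sup>2" for r c :: real
  using zero_le_power2 [of "r - c"] by (simp add: power2_eq_square algebra_simps)

lemma translate_origin: "x \<in> torus L \<Longrightarrow> translate L x (0, 0) = x"
  by (auto simp: translate_def torus_def)

lemma young_origin: "young W \<Longrightarrow> W \<noteq> {} \<Longrightarrow> (0, 0) \<in> W"
  by (auto simp: young_def)

lemma closed_shifts_imp_torus:
  assumes "A \<subseteq> torus L" "x \<in> A" and closed: "\<And>z. z \<in> A \<Longrightarrow> right L z \<in> A" "\<And>z. z \<in> A \<Longrightarrow> up L z \<in> A"
  shows "A = torus L"
proof
  show "torus L \<subseteq> A"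
  proof
    fix z assume "z \<in> torus L"
    then obtain c d where z: "z = (c, d)" "c < L" "d < L" by (auto simp: torus_def)
    obtain a b where x: "x = (a, b)" "a < L" "b < L" using assms(1,2) by (auto simp: torus_def)
    have "(c, b) \<in> A"
      using cyclic_invariant [of a L "\<lambda>u. (u, b) \<in> A" c] x z assms(2) closed(1) by (force simp: right_def)
    then have "(c, d) \<in> A"
      using cyclic_invariant [of b L "\<lambda>u. (c, u) \<in> A" d] x z closed(2) by (force simp: up_def)
    then show "z \<in> A" by (simp add: z)
  qed
qed fact

definition square :: "nat \<Rightarrow> (nat \<times> nat) set" where
  "square k = {..<k} \<times> {..<k}"

lemma finite_square [simp]: "finite (square k)"
  by (simp add: square_def)

lemma card_square: "card (square k) = k * k"
  by (simp add: square_def)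

lemma young_square: "young (square k)"
  by (simp add: square_def young_rect)

lemma square_subset_torus: "k \<le> L \<Longrightarrow> square k \<subseteq> torus L"
  by (auto simp: square_def torus_def)

lemma square_mono: "k \<le> m \<Longrightarrow> square k \<subseteq> square m"
  by (auto simp: square_def)

lemma translate_square_sides:
  assumes "S \<subseteq> translate L x ` square q"
  shows "card (fst ` S) \<le> q" "card (snd ` S) \<le> q"
proof -
  have "fst ` S \<subseteq> (\<lambda>u. (fst x + u) mod L) ` {..<q}" "snd ` S \<subseteq> (\<lambda>u. (snd x + u) mod L) ` {..<q}"
    using assms by (force simp: square_def translate_def)+
  from this [THEN surj_card_le [OF finite_lessThan]]
  show "card (fst ` S) \<le> q" "card (snd ` S) \<le> q" by simp_all
qed

text \<open>With \<open>r, c \<le> q\<close> the product \<open>r * c\<close> is at most \<open>q * (r + c) / 2\<close>, which turns the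
  isoperimetric bound into one that is linear in \<open>r + c\<close>.\<close>

lemma ising_ge_in_square:
  assumes S: "S \<subseteq> translate L x ` square q" and "q < L" "0 \<le> h"
  shows "(real (card (fst ` S)) + real (card (snd ` S))) * (4 - h * real q) \<le> ising h L S"
    and "2 * (2 * (real (card (fst ` S)) + real (card (snd ` S))) - h * real (card S)) \<le> ising h L S"
proof -
  define r c where rc: "r = real (card (fst ` S))" "c = real (card (snd ` S))"
  note sides = translate_square_sides [OF S]
  have fin: "finite S" by (rule finite_subset [OF S]) simp
  have ST: "S \<subseteq> torus L"
  proof
    fix w assume "w \<in> S"
    then obtain z where "z \<in> square q" "w = translate L x z" using S by blast
    then show "w \<in> torus L"
      using square_subset_torus [of q L] assms(2) by (auto intro: translate_in_torus)
  qed
  show *: "2 * (2 * (real (card (fst ` S)) + real (card (snd ` S))) - h * real (card S)) \<le> ising h L S"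
    using ising_ge [OF ST] sides assms(2) by simp
  have "real (card S) \<le> r * c"
    using card_le_fst_snd [OF fin] unfolding rc by (simp flip: of_nat_mult)
  moreover have "r * c \<le> real q * c" "c * r \<le> real q * r"
    using sides by (intro mult_right_mono; simp add: rc)+
  ultimately have "2 * real (card S) \<le> real q * (r + c)"
    by (simp add: algebra_simps)
  then have "h * (2 * real (card S)) \<le> h * (real q * (r + c))"
    using assms(3) by (rule mult_left_mono)
  then show "(real (card (fst ` S)) + real (card (snd ` S))) * (4 - h * real q) \<le> ising h L S"
    using * unfolding rc [symmetric] by (simp add: algebra_simps)
qed

lemma ising_pos_in_square:
  assumes S: "S \<subseteq> translate L x ` square q" "S \<noteq> {}" and "q < L" "0 \<le> h" "h * real q < 4"
  shows "0 < ising h L S"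
proof -
  have "finite S" by (rule finite_subset [OF S(1)]) simp
  then have "0 < real (card (fst ` S))" using S(2) by (simp add: card_gt_0_iff)
  then have "0 < (real (card (fst ` S)) + real (card (snd ` S))) * (4 - h * real q)"
    using assms by (intro mult_pos_pos) auto
  then show ?thesis using ising_ge_in_square(1) [OF S(1) assms(3,4)] by linarith
qed

lemma ising_young_le:
  assumes "young W" "W \<subseteq> {..<a} \<times> {..<b}" "a < L" "b < L" "0 \<le> h" "n \<le> card W"
  shows "ising h L W \<le> 2 * (2 * (real a + real b) - h * real n)"
proof -
  have "h * real n \<le> h * real (card W)" using assms by (intro mult_left_mono) auto
  moreover have "real (perim L W) \<le> 2 * (real a + real b)"
    using of_nat_mono [OF perim_young_le [OF assms(1-4)], where ?'a = real] by simp
  ultimately show ?thesis by (simp add: ising_def)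
qed

text \<open>Once \<open>4 < h * q\<close>, the bound linear in the sum of the sides decreases in
  that sum. A smaller sum gives higher energy by this bound alone; when both sides equal
  \<open>q\<close>, the missing area decides.\<close>

lemma square_strict_minimum:
  assumes S: "S \<subset> translate L x ` square q" and q: "q < L" and h: "0 < h" "4 < h * real q"
  shows "ising h L (square q) < ising h L S"
proof -
  define s where "s = card (fst ` S) + card (snd ` S)"
  have S': "S \<subseteq> translate L x ` square q" using S by blast
  have sq: "ising h L (square q) \<le> 2 * real q * (4 - h * real q)"
    using ising_young_le [of "square q" q q L h "q * q"] q h(1)
    by (simp add: young_square card_square) (simp add: square_def algebra_simps)
  have "s \<le> 2 * q" using translate_square_sides [OF S'] by (simp add: s_def)
  show ?thesis
  proof (cases "s = 2 * q")
    case True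
    have "card S < card (translate L x ` square q)" using S by (intro psubset_card_mono) auto
    also have "\<dots> \<le> q * q" using card_image_le [of "square q" "translate L x"] by (simp add: card_square)
    finally have less: "h * real (card S) < h * real (q * q)"
      using h(1) by (intro mult_strict_left_mono) (simp_all only: of_nat_less_iff)
    have "real (card (fst ` S)) + real (card (snd ` S)) = 2 * real q"
      using True unfolding s_def by linarith
    then have "8 * real q - 2 * (h * real (card S)) \<le> ising h L S"
      using ising_ge_in_square(2) [OF S' q, of h] h(1) by simp
    moreover have "ising h L (square q) \<le> 8 * real q - 2 * (h * real (q * q))"
      using sq by (simp add: algebra_simps)
    ultimately show ?thesis using less by argo
  next
    case False
    then have "real s < 2 * real q" using \<open>s \<le> 2 * q\<close> by linarith
    then have "2 * real q * (4 - h * real q) < real s * (4 - h * real q)"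
      using h(2) by (intro mult_strict_right_mono_neg) auto
    then show ?thesis
      using ising_ge_in_square(1) [OF S' q, of h] h(1) sq by (simp add: s_def)
  qed
qed

text \<open>A flip is seen by one layer only, chosen by parity. Areas grow by at most one, so they
  cannot jump over the critical area.\<close>

lemma card_layer_fun_upd:
  "card (layer L \<xi> (\<eta>(x := a))) = card (layer L \<xi> \<eta>) \<and> card (layer L (\<eta>(x := a)) \<xi>) \<le> Suc (card (layer L \<eta> \<xi>)) \<or>
   card (layer L (\<eta>(x := a)) \<xi>) = card (layer L \<eta> \<xi>) \<and> card (layer L \<xi> (\<eta>(x := a))) \<le> Suc (card (layer L \<xi> \<eta>))"
proof (cases "even (fst x + snd x)")
  case True
  then have "layer L \<xi> (\<eta>(x := a)) = layer L \<xi> \<eta>" unfolding layer_def by (intro Collect_cong) auto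
  moreover have "card (layer L (\<eta>(x := a)) \<xi>) \<le> card (insert x (layer L \<eta> \<xi>))"
    by (intro card_mono) (auto simp: layer_def)
  ultimately show ?thesis using card_insert_le_m1 [of "Suc (card (layer L \<eta> \<xi>))" "layer L \<eta> \<xi>" x] by simp
next
  case False
  then have "layer L (\<eta>(x := a)) \<xi> = layer L \<eta> \<xi>" unfolding layer_def by (intro Collect_cong) auto
  moreover have "card (layer L \<xi> (\<eta>(x := a))) \<le> card (insert x (layer L \<xi> \<eta>))"
    by (intro card_mono) (auto simp: layer_def)
  ultimately show ?thesis using card_insert_le_m1 [of "Suc (card (layer L \<xi> \<eta>))" "layer L \<xi> \<eta>" x] by simp
qed

text \<open>The last two assumptions say \<open>l - 1 \<le> 2 / h < l\<close>, which makes
  \<open>l\<close> the critical length. Since \<open>l * l < L\<close>, sets of area at most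
  \<open>l * l\<close> cannot project onto a full side.\<close>

locale critical =
  fixes h :: real and L l :: nat
  assumes h: "0 < h" "h < 1/4" and evenL: "even L" and L_large: "l * l < L"
    and l: "h * (real l - 1) \<le> 2" "2 < h * real l"
begin

text \<open>Energy of the critical droplet, an \<open>l\<close> by \<open>l - 1\<close> rectangle
  with one site attached to a longer side: perimeter \<open>4 l\<close>, area
  \<open>n_crit\<close>.\<close>

definition "\<Gamma> = 2 * (4 * real l - h * ((real l)\<^sup>2 - real l + 1))"

definition "n_crit = l * (l - 1) + 1"

lemma l_ge: "9 \<le> l"
proof -
  have "h * real l \<le> 1/4 * real l" using h by (intro mult_right_mono) auto
  then show ?thesis using l(2) by linarith
qed

lemma L_ge: "9 * l < L" "81 \<le> L"
  using mult_right_mono [OF l_ge, of l] L_large l_ge by linarith+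

lemma real_n_crit: "real n_crit = (real l)\<^sup>2 - real l + 1"
  using l_ge by (simp add: n_crit_def of_nat_diff power2_eq_square algebra_simps)

lemma n_crit_le: "n_crit \<le> l * l"
proof -
  have "l * (l - 1) + l = l * l" using l_ge by (cases l) simp_all
  then show ?thesis using l_ge unfolding n_crit_def by linarith
qed

text \<open>A crude bound; \<open>ising_diff_lt\<close> needs \<Gamma> to exceed 26.\<close>

lemma Gamma_ge: "35 \<le> \<Gamma>"
proof -
  have "(h * real l) * real l \<le> (2 + h) * real l"
    using l(1) by (intro mult_right_mono) (auto simp: algebra_simps)
  then have "2 * (2 * real l - h) \<le> \<Gamma>"
    unfolding \<Gamma>_def by (simp add: algebra_simps power2_eq_square)
  moreover have "9 \<le> real l" using l_ge by linarith
  ultimately show ?thesis using h unfolding right_diff_distrib by linarith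
qed

text \<open>The difference of the two sides is \<open>2 * (l - k) * (4 - h * (l + k - 1))\<close>.
  Its last factor changes sign exactly as \<open>k\<close> passes \<open>l\<close>, by the two
  inequalities defining \<open>l\<close>.\<close>

lemma Gamma_max:
  "2 * (4 * real k - h * ((real k)\<^sup>2 - real k + 1)) \<le> \<Gamma>"
proof -
  have "0 \<le> (real l - real k) * (4 - h * (real l + real k - 1))"
  proof (cases "k < l")
    case True
    then have "h * (real l + real k - 1) \<le> h * (2 * (real l - 1))"
      using h by (intro mult_left_mono) auto
    also have "\<dots> = 2 * (h * (real l - 1))" by simp
    finally have "h * (real l + real k - 1) \<le> 4" using l(1) by linarith
    then show ?thesis using True by (intro mult_nonneg_nonneg) auto
  next
    case False
    show ?thesis
    proof (cases "k = l")
      case neq: False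
      then have "h * (2 * real l) \<le> h * (real l + real k - 1)"
        using h False by (intro mult_left_mono) auto
      then show ?thesis using False l(2) by (intro mult_nonpos_nonpos) auto
    qed simp
  qed
  then show ?thesis unfolding \<Gamma>_def by (simp add: algebra_simps power2_eq_square)
qed

lemma sides_lt:
  assumes "S \<subseteq> torus L" "card S \<le> l * l"
  shows "card (fst ` S) < L" "card (snd ` S) < L"
proof -
  have "finite S" by (rule finite_subset [OF assms(1) finite_torus])
  then show "card (fst ` S) < L" "card (snd ` S) < L"
    using card_image_le [of S fst] card_image_le [of S snd] assms(2) L_large by linarith+
qed

text \<open>With area \<open>n\<close> and sides \<open>r\<close> and \<open>c\<close>, the bounds
  \<open>n \<le> l^2\<close> and \<open>h * l \<le> 4\<close> give \<open>(h * n)^2 \<le> 16 * n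
  \<le> 16 * r * c \<le> (2 * (r + c))^2\<close>.\<close>

lemma ising_nonneg:
  assumes S: "S \<subseteq> torus L" "card S \<le> l * l"
  shows "0 \<le> ising h L S"
proof -
  define r c n where rcn: "r = real (card (fst ` S))" "c = real (card (snd ` S))" "n = real (card S)"
  have "finite S" by (rule finite_subset [OF S(1) finite_torus])
  from card_le_fst_snd [OF this] have nrc: "n \<le> r * c"
    unfolding rcn by (simp flip: of_nat_mult)
  have nn: "0 \<le> n" "0 \<le> r" "0 \<le> c" by (simp_all add: rcn)
  have "h * real l \<le> 4" using l(1) h by (simp add: algebra_simps)
  then have "(h * real l)\<^sup>2 \<le> 4\<^sup>2" using h by (intro power_mono) auto
  have "(h * n)\<^sup>2 = h\<^sup>2 * n * n" by (simp add: power2_eq_square)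
  also have "\<dots> \<le> h\<^sup>2 * (real l)\<^sup>2 * n"
  proof -
    have "n \<le> (real l)\<^sup>2" using S(2) unfolding rcn by (simp add: power2_eq_square flip: of_nat_mult)
    then show ?thesis using nn by (intro mult_right_mono mult_left_mono) auto
  qed
  also have "\<dots> \<le> 16 * n"
    using \<open>(h * real l)\<^sup>2 \<le> 4\<^sup>2\<close> nn by (intro mult_right_mono) (auto simp: power_mult_distrib)
  also have "\<dots> \<le> (2 * (r + c))\<^sup>2"
    using nrc four_mult_le_square [of r c] unfolding power_mult_distrib by simp
  finally have "h * n \<le> 2 * (r + c)" by (rule power2_le_imp_le) (use nn in simp)
  then have "0 \<le> 2 * (2 * (r + c) - h * n)" using nn by simp
  also have "\<dots> \<le> ising h L S" unfolding rcn by (rule ising_ge [OF S(1) sides_lt [OF S]])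
  finally show ?thesis .
qed

text \<open>If the sides summed to at most \<open>2 l - 1\<close>, the area would be at most
  \<open>(2 l - 1)^2 / 4 = l * (l - 1) + 1/4\<close>, below \<open>n_crit\<close>.\<close>

lemma ising_ge_Gamma:
  assumes S: "S \<subseteq> torus L" "card S = n_crit"
  shows "\<Gamma> \<le> ising h L S"
proof -
  define r c where rc: "r = card (fst ` S)" "c = card (snd ` S)"
  have "finite S" by (rule finite_subset [OF S(1) finite_torus])
  from card_le_fst_snd [OF this] have "real n_crit \<le> real r * real c"
    unfolding rc S(2) [symmetric] by (simp flip: of_nat_mult)
  have "2 * l \<le> r + c"
  proof (rule ccontr)
    assume "\<not> 2 * l \<le> r + c"
    then have "real r + real c \<le> 2 * real l - 1" by linarith
    then have "(real r + real c)\<^sup>2 \<le> (2 * real l - 1)\<^sup>2" by (intro power_mono) auto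
    then have "4 * real n_crit \<le> (2 * real l - 1)\<^sup>2"
      using four_mult_le_square [of "real r" "real c"] \<open>real n_crit \<le> real r * real c\<close> by linarith
    then show False unfolding real_n_crit by (simp add: power2_eq_square algebra_simps)
  qed
  then have "2 * real l \<le> real r + real c" by linarith
  moreover have "card S \<le> l * l" using S(2) n_crit_le by simp
  ultimately show ?thesis
    using ising_ge [OF S(1) sides_lt [OF S(1)], of h]
    unfolding \<Gamma>_def S(2) rc real_n_crit by simp
qed

section \<open>Energies relative to all-minus, and the lower bound\<close>

definition "base = 2 * (h - 2) * real (L * L)"

lemma trans_energy_base:
  assumes "\<sigma> \<in> configs L" "\<eta> \<in> configs L"
  shows "trans_energy h L \<sigma> \<eta> = base + ising h L (layer L \<sigma> \<eta>) + ising h L (layer L \<eta> \<sigma>)"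
  using assms evenL L_ge unfolding base_def by (intro trans_energy_layer) auto

lemma energy_base:
  assumes "\<sigma> \<in> configs L"
  shows "energy h L \<sigma> = base + ising h L (layer L \<sigma> (relax h L \<sigma>)) + ising h L (layer L (relax h L \<sigma>) \<sigma>)"
  using trans_energy_base [OF assms relax_in_configs [of h L \<sigma>]] by (simp add: trans_energy_relax)

lemma ising_small_layer: "card (layer L \<sigma> \<eta>) < n_crit \<Longrightarrow> 0 \<le> ising h L (layer L \<sigma> \<eta>)"
  using ising_nonneg [OF layer_subset] n_crit_le by simp

lemma ising_crit_layer: "card (layer L \<sigma> \<eta>) = n_crit \<Longrightarrow> \<Gamma> \<le> ising h L (layer L \<sigma> \<eta>)"
  using ising_ge_Gamma [OF layer_subset] by simp

lemma ising_layer_ge_torus: "ising h L (torus L) \<le> ising h L (layer L \<sigma> \<eta>)"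
  using h by (intro ising_ge_torus layer_subset) simp

text \<open>While both areas are below \<open>n_crit\<close>, both Ising energies are nonnegative,
  so no energy is below \<open>base\<close>. On leaving this region one area equals
  \<open>n_crit\<close> and the other is still below it, so the transition energy is at least
  \<open>base + \<Gamma>\<close>.\<close>

lemma stab_level_ge_both_empty:
  assumes \<sigma>: "\<sigma> \<in> configs L" "layer L \<sigma> (relax h L \<sigma>) = {}" "layer L (relax h L \<sigma>) \<sigma> = {}"
  shows "ereal \<Gamma> \<le> stab_level h L \<sigma>"
proof -
  define G where "G \<xi> \<eta> \<longleftrightarrow> card (layer L \<xi> \<eta>) < n_crit \<and> card (layer L \<eta> \<xi>) < n_crit" for \<xi> \<eta>
  have e: "energy h L \<sigma> = base" using energy_base [OF \<sigma>(1)] \<sigma> by simp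
  have flip: "G \<xi> (\<eta>(x := a))"
    if "\<xi> \<in> configs L" "\<eta> \<in> configs L" "x \<in> torus L" "\<eta>(x := a) \<in> configs L" "G \<xi> \<eta>"
      "trans_energy h L \<xi> (\<eta>(x := a)) < base + \<Gamma>" for \<xi> \<eta> x a
  proof (rule ccontr)
    assume "\<not> G \<xi> (\<eta>(x := a))"
    then consider "card (layer L (\<eta>(x := a)) \<xi>) = n_crit" "card (layer L \<xi> (\<eta>(x := a))) < n_crit"
      | "card (layer L \<xi> (\<eta>(x := a))) = n_crit" "card (layer L (\<eta>(x := a)) \<xi>) < n_crit"
      using card_layer_fun_upd [of L \<xi> \<eta> x a] \<open>G \<xi> \<eta>\<close> unfolding G_def by linarith
    then show False
      using trans_energy_base [OF that(1) that(4)] that(6) by cases (use ising_small_layer ising_crit_layer in fastforce)+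
  qed
  have "base + \<Gamma> \<le> height h L \<omega>" if "\<eta> \<in> lower h L \<sigma>" "\<omega> \<in> paths L \<sigma> \<eta>" for \<eta> \<omega>
  proof (rule ccontr)
    assume less: "\<not> base + \<Gamma> \<le> height h L \<omega>"
    have \<eta>: "\<eta> \<in> configs L" "energy h L \<eta> < base" using that e by (auto simp: lower_def)
    have "G \<eta> (relax h L \<eta>)"
    proof (rule path_invariant [of L \<sigma> h "base + \<Gamma>" G \<omega> \<eta>, OF evenL])
      show "G \<sigma> (relax h L \<sigma>)" by (simp add: G_def \<sigma> n_crit_def)
    qed (use L_ge \<sigma>(1) e Gamma_ge that less \<eta> flip in \<open>auto simp: G_def\<close>)
    then show False
      using energy_base [OF \<eta>(1)] \<eta>(2) ising_small_layer [of \<eta> "relax h L \<eta>"] ising_small_layer [of "relax h L \<eta>" \<eta>]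
      unfolding G_def by linarith
  qed
  from stab_level_ge [OF \<sigma>(1) this] show ?thesis by (simp add: e)
qed

text \<open>With one layer full, the invariant asks only that some layer be below
  \<open>n_crit\<close>. The other is controlled because no layer has energy below that of the
  torus, which is part of the reference energy.\<close>

lemma stab_level_ge_one_empty:
  assumes \<sigma>: "\<sigma> \<in> configs L" "{layer L \<sigma> (relax h L \<sigma>), layer L (relax h L \<sigma>) \<sigma>} = {{}, torus L}"
  shows "ereal \<Gamma> \<le> stab_level h L \<sigma>"
proof -
  define G where "G \<xi> \<eta> \<longleftrightarrow> card (layer L \<xi> \<eta>) < n_crit \<or> card (layer L \<eta> \<xi>) < n_crit" for \<xi> \<eta>
  let ?M = "base + ising h L (torus L)"
  have cases: "layer L \<sigma> (relax h L \<sigma>) = {} \<and> layer L (relax h L \<sigma>) \<sigma> = torus L \<or>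
      layer L \<sigma> (relax h L \<sigma>) = torus L \<and> layer L (relax h L \<sigma>) \<sigma> = {}"
    using \<sigma>(2) by (auto simp: doubleton_eq_iff)
  then have e: "energy h L \<sigma> = ?M" using energy_base [OF \<sigma>(1)] by auto
  have flip: "G \<xi> (\<eta>(x := a))"
    if "\<xi> \<in> configs L" "\<eta> \<in> configs L" "x \<in> torus L" "\<eta>(x := a) \<in> configs L" "G \<xi> \<eta>"
      "trans_energy h L \<xi> (\<eta>(x := a)) < ?M + \<Gamma>" for \<xi> \<eta> x a
  proof (rule ccontr)
    assume "\<not> G \<xi> (\<eta>(x := a))"
    then consider "card (layer L (\<eta>(x := a)) \<xi>) = n_crit" | "card (layer L \<xi> (\<eta>(x := a))) = n_crit"
      using card_layer_fun_upd [of L \<xi> \<eta> x a] \<open>G \<xi> \<eta>\<close> unfolding G_def by linarith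
    then show False
      using trans_energy_base [OF that(1) that(4)] that(6)
        ising_layer_ge_torus [of \<xi> "\<eta>(x := a)"] ising_layer_ge_torus [of "\<eta>(x := a)" \<xi>]
      by cases (use ising_crit_layer in fastforce)+
  qed
  have "?M + \<Gamma> \<le> height h L \<omega>" if "\<eta> \<in> lower h L \<sigma>" "\<omega> \<in> paths L \<sigma> \<eta>" for \<eta> \<omega>
  proof (rule ccontr)
    assume less: "\<not> ?M + \<Gamma> \<le> height h L \<omega>"
    have \<eta>: "\<eta> \<in> configs L" "energy h L \<eta> < ?M" using that e by (auto simp: lower_def)
    have "G \<eta> (relax h L \<eta>)"
    proof (rule path_invariant [of L \<sigma> h "?M + \<Gamma>" G \<omega> \<eta>, OF evenL])
      show "G \<sigma> (relax h L \<sigma>)" using cases by (auto simp: G_def n_crit_def)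
    qed (use L_ge \<sigma>(1) e Gamma_ge that less \<eta> flip in \<open>auto simp: G_def\<close>)
    then show False
      using energy_base [OF \<eta>(1)] \<eta>(2) ising_small_layer [of \<eta> "relax h L \<eta>"] ising_small_layer [of "relax h L \<eta>" \<eta>]
        ising_layer_ge_torus [of \<eta> "relax h L \<eta>"] ising_layer_ge_torus [of "relax h L \<eta>" \<eta>]
      unfolding G_def by linarith
  qed
  from stab_level_ge [OF \<sigma>(1) this] show ?thesis by (simp add: e)
qed

subsection \<open>Growing a droplet\<close>

text \<open>Below side \<open>4 / h\<close> the overlap \<open>S\<close> has positive energy. In the
  last stage beyond it, \<open>S\<close> may have negative energy, but \<open>W\<close> has by then
  come far down from the barrier.\<close>

lemma ising_diff_lt:
  assumes W: "young W" "W \<subseteq> square (Suc k)" "Suc (k * k) \<le> card W" "ising h L W \<le> \<Gamma>"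
    and k: "h * real k \<le> 4" "Suc k < L"
    and S: "S \<subseteq> translate L x ` W" "S \<noteq> {}"
  shows "ising h L W - ising h L S < \<Gamma>"
proof (cases "h * real (Suc k) < 4")
  case True
  have "0 < ising h L S"
    using S W(2) k(2) h True by (intro ising_pos_in_square [of S L x "Suc k"]) auto
  then show ?thesis using W(4) by linarith
next
  case False
  define q where "q = real (Suc k)"
  have hq: "4 \<le> h * q" "h * q \<le> 4 + h" "0 \<le> q"
    using False k(1) by (simp_all add: q_def algebra_simps)
  have S': "S \<subseteq> translate L x ` square (Suc k)" using S W(2) by blast
  \<comment> \<open>The linear bound is now least at full sides, and
    \<open>2 * q * h \<le> 8 + 2 * h < 10\<close>.\<close>
  have "- (2 * q) * h \<le> (2 * q) * (4 - h * q)"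
    using mult_left_mono [of "- h" "4 - h * q" "2 * q"] hq by simp
  also have "\<dots> \<le> (real (card (fst ` S)) + real (card (snd ` S))) * (4 - h * q)"
    using translate_square_sides [OF S'] hq(1) by (intro mult_right_mono_neg) (auto simp: q_def)
  also have "\<dots> \<le> ising h L S"
    using ising_ge_in_square(1) [OF S' k(2), of h] h by (simp add: q_def)
  finally have lower: "- 10 \<le> ising h L S" using hq h by (simp add: algebra_simps)
  \<comment> \<open>As \<open>h * k\<close> is within \<open>h\<close> of 4, area and perimeter
    terms of \<open>W\<close> cancel up to a constant.\<close>
  have "(4 - h) * real k \<le> (h * real k) * real k"
    using hq by (intro mult_right_mono) (auto simp: q_def algebra_simps)
  then have "4 * real k - 4 \<le> h * real (k * k)"
    using k(1) by (simp add: algebra_simps)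
  moreover have "ising h L W \<le> 2 * (2 * (real (Suc k) + real (Suc k)) - h * real (k * k))"
    using W k h by (intro ising_young_le) (auto simp: square_def)
  ultimately have "ising h L W \<le> 16" by simp
  then show ?thesis using lower Gamma_ge by linarith
qed

text \<open>The induction passes from the \<open>k\<close> by \<open>k\<close> square through a
  \<open>k\<close> by \<open>k + 1\<close> rectangle to the next square, one site at a time. The
  last premise of \<open>step\<close> is the strict bound to be combined with submodularity.\<close>

lemma square_grow [consumes 3, case_names base step]:
  assumes "m < L" "h * (real m - 1) \<le> 4" "x \<in> torus L"
    and base: "P {}"
    and step: "\<And>W z. \<lbrakk>P W; z \<in> square m; W \<subseteq> square m; young (insert z W); insert z W \<subseteq> square m;
        ising h L (insert z W) \<le> \<Gamma>;
        \<And>S. S \<subseteq> translate L x ` insert z W \<Longrightarrow> S \<noteq> {} \<Longrightarrow> ising h L (insert z W) - ising h L S < \<Gamma>\<rbrakk>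
      \<Longrightarrow> P (insert z W)"
  shows "P (square m)"
proof -
  have "P (square k)" if "k \<le> m" for k
    using that
  proof (induction k)
    case 0
    then show ?case using base by (simp add: square_def)
  next
    case (Suc k)
    then have km: "Suc k \<le> m" and P: "P (square k)" by auto
    have "h * real k \<le> h * (real m - 1)" using km h by (intro mult_left_mono) auto
    then have hk: "h * real k \<le> 4" using assms(2) by linarith
    have kL: "Suc k < L" using km assms(1) by linarith
    \<comment> \<open>Both halves of the passage share this one-site step from \<open>X\<close>
      towards \<open>Y\<close>; they differ in how the bound by \<Gamma> is obtained.\<close>
    have stage: "P (insert z W)"
      if "P W" "X \<subseteq> W" "z \<in> Y - W" "insert z W \<subseteq> Y" "young (insert z W)" and X: "finite X" "k * k \<le> card X"
        and Y: "Y \<subseteq> square (Suc k)" "\<And>V. young V \<Longrightarrow> V \<subseteq> Y \<Longrightarrow> card X < card V \<Longrightarrow> ising h L V \<le> \<Gamma>"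
      for X Y W z
    proof -
      have fin: "finite W" using that(4) Y(1) by (meson finite_square finite_subset insert_subset)
      have "card X \<le> card W" using fin that(2) by (rule card_mono)
      then have card: "card X < card (insert z W)" using that(3) fin by simp
      have le: "ising h L (insert z W) \<le> \<Gamma>" using Y(2) that card by blast
      have sub: "insert z W \<subseteq> square (Suc k)" using that Y by blast
      have *: "ising h L (insert z W) - ising h L S < \<Gamma>" if "S \<subseteq> translate L x ` insert z W" "S \<noteq> {}" for S
        using card X(2) by (intro ising_diff_lt [OF \<open>young (insert z W)\<close> sub _ le hk kL that]) simp
      have "square (Suc k) \<subseteq> square m" using km by (rule square_mono)
      then show ?thesis using that(1,5) sub le * by (intro step) auto
    qed
    let ?X = "square k" and ?Y = "{..<k} \<times> {..<Suc k}" and ?Z = "square (Suc k)"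
    have fin: "finite ?Y" "finite ?Z" and yX: "young ?X" and yY: "young ?Y" and yZ: "young ?Z"
      and XY: "?X \<subseteq> ?Y" and YZ: "?Y \<subseteq> ?Z"
      by (auto simp: young_rect square_def)
    have "P ?Y"
      using fin(1) yX yY XY
    proof (induction rule: young_grow)
      case (step W z)
      show ?case
      proof (rule stage [OF step(1,2,3,4,5)])
        fix V assume V: "young V" "V \<subseteq> ?Y" "card ?X < card V"
        have "ising h L V \<le> 2 * (2 * (real k + real (Suc k)) - h * real (Suc (k * k)))"
          using V kL h by (intro ising_young_le) (auto simp: card_square)
        \<comment> \<open>The average of the values in \<open>Gamma_max\<close> at \<open>k\<close>
          and \<open>Suc k\<close>.\<close>
        also have "\<dots> \<le> \<Gamma>"
          using Gamma_max [of k] Gamma_max [of "Suc k"] by (simp add: power2_eq_square algebra_simps)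
        finally show "ising h L V \<le> \<Gamma>" .
      qed (use YZ in \<open>auto simp: card_square\<close>)
    qed (rule P)
    show ?case
      using fin(2) yY yZ YZ
    proof (induction rule: young_grow)
      case (step W z)
      show ?case
      proof (rule stage [OF step(1,2,3,4,5)])
        fix V assume V: "young V" "V \<subseteq> ?Z" "card ?Y < card V"
        then have "Suc (k * Suc k) \<le> card V" by (simp add: card_cartesian_product)
        then have "ising h L V \<le> 2 * (2 * (real (Suc k) + real (Suc k)) - h * real (Suc (k * Suc k)))"
          using V kL h by (intro ising_young_le) (auto simp: square_def)
        \<comment> \<open>Exactly the value in \<open>Gamma_max\<close> at
          \<open>Suc k\<close>.\<close>
        also have "\<dots> \<le> \<Gamma>"
          using Gamma_max [of "Suc k"] by (simp add: power2_eq_square algebra_simps)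
        finally show "ising h L V \<le> \<Gamma>" .
      qed (use fin in \<open>auto simp: card_cartesian_product\<close>)
    qed (rule \<open>P ?Y\<close>)
  qed
  then show ?thesis by blast
qed

text \<open>The least side beyond \<open>4 / h\<close>: large enough for
  \<open>square_strict_minimum\<close>, small enough for \<open>square_grow\<close>.\<close>

definition "final_side = nat \<lfloor>4 / h\<rfloor> + 1"

lemma final_side: "h * (real final_side - 1) \<le> 4" "4 < h * real final_side" "final_side < L" "2 \<le> final_side"
proof -
  have pos: "0 \<le> 4 / h" using h by simp
  have side: "real final_side = of_int \<lfloor>4 / h\<rfloor> + 1" using pos by (simp add: final_side_def)
  have "of_int \<lfloor>4 / h\<rfloor> \<le> 4 / h" "4 / h < of_int \<lfloor>4 / h\<rfloor> + 1" by linarith+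
  then have "real final_side - 1 \<le> 4 / h" "4 / h < real final_side" unfolding side by linarith+
  then show *: "h * (real final_side - 1) \<le> 4" and gt: "4 < h * real final_side"
    using h by (simp_all add: field_simps)
  have "h * (real final_side - 1) < h * (2 * real l)" using * l(2) by (simp add: mult.left_commute)
  then have "real final_side - 1 < 2 * real l" using h by simp
  then have "final_side \<le> 2 * l" by linarith
  then show "final_side < L" using L_ge(1) by linarith
  have "h * real final_side \<le> 1/4 * real final_side" using h by (intro mult_right_mono) auto
  then show "2 \<le> final_side" using gt by linarith
qed

text \<open>Every nonempty Young diagram contains the origin, so its translate contains
  \<open>x\<close>. If \<open>A\<close> is nonempty, the overlap is therefore nonempty from the
  first site on, and submodularity gives a strict bound.\<close>

lemma reach_grow:
  assumes r: "reach h L U \<sigma> (interleave L A B) (interleave L B A)"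
    and AB: "A \<subseteq> torus L" "B \<subseteq> torus L" and x: "x \<in> torus L" "A = {} \<or> x \<in> A"
    and U: "\<And>e. A = {} \<and> e \<le> \<Gamma> \<or> e < ising h L A + \<Gamma> \<Longrightarrow> base + e + ising h L B \<in> U"
  defines "R \<equiv> translate L x ` square final_side"
  shows "reach h L U \<sigma> (interleave L (A \<union> R) B) (interleave L B (A \<union> R))"
  unfolding R_def using final_side(3,1) x(1)
proof (induction rule: square_grow)
  case base
  then show ?case using r by simp
next
  case (step W z)
  let ?W = "insert z W" and ?\<tau> = "translate L x"
  have sq: "square final_side \<subseteq> torus L" using final_side(3) by (intro square_subset_torus) simp
  have WT: "?\<tau> ` ?W \<subseteq> torus L" using step(5) sq translate_in_torus by blast
  have fin: "finite A" "finite (?\<tau> ` ?W)"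
    using AB(1) WT finite_subset [OF _ finite_torus [of L]] by blast+
  have e: "ising h L (?\<tau> ` ?W) = ising h L ?W" using step(5) sq by (intro ising_translate) blast
  have "A = {} \<and> ising h L (A \<union> ?\<tau> ` ?W) \<le> \<Gamma> \<or> ising h L (A \<union> ?\<tau> ` ?W) < ising h L A + \<Gamma>"
  proof (cases "A = {}")
    case True
    then show ?thesis using step(6) e by simp
  next
    case False
    have "?\<tau> (0, 0) \<in> ?\<tau> ` ?W" using young_origin [OF step(4)] by blast
    then have "A \<inter> ?\<tau> ` ?W \<noteq> {}" using x False translate_origin [OF x(1)] by auto
    then have "ising h L ?W - ising h L (A \<inter> ?\<tau> ` ?W) < \<Gamma>" by (intro step(7)) auto
    then show ?thesis using ising_submodular [OF fin, of h L] e by linarith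
  qed
  from U [OF this] have u: "base + ising h L (A \<union> ?\<tau> ` ?W) + ising h L B \<in> U" .
  have ins: "A \<union> ?\<tau> ` ?W = insert (?\<tau> z) (A \<union> ?\<tau> ` W)" by auto
  show ?case
    unfolding ins
  proof (rule reach_insert [OF step(1) evenL])
    show "2 * (h - 2) * real (L * L) + ising h L (insert (?\<tau> z) (A \<union> ?\<tau> ` W)) + ising h L B \<in> U"
      using u unfolding ins base_def .
  qed (use L_ge AB WT in auto)
qed

text \<open>If all squares cornered in a nonempty \<open>A\<close> stayed in \<open>A\<close>, it
  would be closed under right and up shifts, since the side is at least 2, and so be the torus. A
  square \<open>R\<close> not contained in \<open>A\<close> has less energy than
  \<open>A \<inter> R\<close>, and submodularity applies.\<close>

lemma exists_lower_union:
  assumes A: "A \<subset> torus L"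
  obtains x where "x \<in> torus L" "A = {} \<or> x \<in> A"
    "ising h L (A \<union> translate L x ` square final_side) < ising h L A"
proof -
  have "\<exists>x\<in>torus L. (A = {} \<or> x \<in> A) \<and> \<not> translate L x ` square final_side \<subseteq> A"
  proof (cases "A = {}")
    case True
    have "(0, 0) \<in> torus L" using L_ge by (simp add: torus_def)
    moreover have "(0, 0) \<in> square final_side" using final_side(4) by (simp add: square_def)
    ultimately show ?thesis using True by (intro bexI [of _ "(0, 0)"]) auto
  next
    case False
    then obtain y where y: "y \<in> A" by blast
    show ?thesis
    proof (rule ccontr)
      assume "\<not> ?thesis"
      then have sub: "translate L x ` square final_side \<subseteq> A" if "x \<in> A" for x using A that by blast
      have "right L x \<in> A \<and> up L x \<in> A" if "x \<in> A" for x
      proof -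
        have "(1, 0) \<in> square final_side" "(0, 1) \<in> square final_side"
          using final_side(4) by (simp_all add: square_def)
        then have "translate L x (1, 0) \<in> A" "translate L x (0, 1) \<in> A" using sub [OF that] by blast+
        moreover have "x \<in> torus L" using A that by blast
        ultimately show ?thesis by (auto simp: translate_def right_def up_def torus_def)
      qed
      then have "A = torus L" using A y by (intro closed_shifts_imp_torus) auto
      then show False using A by blast
    qed
  qed
  then obtain x where x: "x \<in> torus L" "A = {} \<or> x \<in> A" "\<not> translate L x ` square final_side \<subseteq> A" by blast
  let ?R = "translate L x ` square final_side"
  have sq: "square final_side \<subseteq> torus L" using final_side(3) by (intro square_subset_torus) simp
  have "finite A" using A finite_subset [OF _ finite_torus [of L]] by blast
  then have "ising h L (A \<union> ?R) + ising h L (A \<inter> ?R) \<le> ising h L A + ising h L ?R"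
    by (intro ising_submodular) auto
  moreover have "ising h L ?R = ising h L (square final_side)" using sq by (rule ising_translate)
  moreover have "ising h L (square final_side) < ising h L (A \<inter> ?R)"
    using x(3) final_side h by (intro square_strict_minimum [of _ L x]) auto
  ultimately show ?thesis using that [OF x(1,2)] by linarith
qed

text \<open>\<open>A\<close> is either layer, as long as it is not full; it grows while
  \<open>B\<close> stays fixed. The same path serves both claims, with \<open>U\<close> open at its
  upper end exactly when \<open>A\<close> is nonempty.\<close>

lemma stab_level_le_Gamma:
  assumes \<sigma>: "\<sigma> \<in> configs L"
    and AB: "(A, B) = (layer L \<sigma> (relax h L \<sigma>), layer L (relax h L \<sigma>) \<sigma>) \<or>
      (B, A) = (layer L \<sigma> (relax h L \<sigma>), layer L (relax h L \<sigma>) \<sigma>)"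
    and A: "A \<noteq> torus L"
  shows "stab_level h L \<sigma> \<le> ereal \<Gamma>" and "A \<noteq> {} \<Longrightarrow> stab_level h L \<sigma> < ereal \<Gamma>"
proof -
  define U where "U = (if A = {} then {..energy h L \<sigma> + \<Gamma>} else {..<energy h L \<sigma> + \<Gamma>})"
  have sub: "A \<subset> torus L" "A \<subseteq> torus L" "B \<subseteq> torus L"
    using AB A layer_subset [of L \<sigma> "relax h L \<sigma>"] layer_subset [of L "relax h L \<sigma>" \<sigma>] by auto
  have e: "energy h L \<sigma> = base + ising h L A + ising h L B"
    using energy_base [OF \<sigma>] AB by auto
  have start: "reach h L U \<sigma> \<sigma> (relax h L \<sigma>)"
    using Gamma_ge by (intro reach.start) (auto simp: trans_energy_relax U_def)
  have L3: "3 \<le> L" using L_ge by simp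
  have "\<sigma> = interleave L A B \<and> relax h L \<sigma> = interleave L B A \<or>
      \<sigma> = interleave L B A \<and> relax h L \<sigma> = interleave L A B"
    using AB interleave_layer [OF \<sigma> relax_in_configs [of h L \<sigma>]] interleave_layer [OF relax_in_configs [of h L \<sigma>] \<sigma>]
    by auto
  then have r: "reach h L U \<sigma> (interleave L A B) (interleave L B A)"
    using start reach_interleave_swap [OF _ evenL L3] by auto
  obtain x where x: "x \<in> torus L" "A = {} \<or> x \<in> A"
    and lower: "ising h L (A \<union> translate L x ` square final_side) < ising h L A"
    using exists_lower_union [OF sub(1)] by blast
  define A' where "A' = A \<union> translate L x ` square final_side"
  have A': "A' \<subseteq> torus L"
    using sub(2) square_subset_torus [of final_side L] final_side(3) translate_in_torus
    unfolding A'_def by fastforce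
  have r': "reach h L U \<sigma> (interleave L A' B) (interleave L B A')"
    unfolding A'_def using e by (intro reach_grow [OF r sub(2,3) x]) (auto simp: U_def)
  \<comment> \<open>The energy of the endpoint is at most any transition energy out of it, so the
    drop in the Ising energy of \<open>A'\<close> suffices.\<close>
  have "energy h L (interleave L B A') \<le> trans_energy h L (interleave L B A') (interleave L A' B)"
    by (rule energy_le_trans_energy) simp
  also have "\<dots> = base + ising h L B + ising h L A'"
    unfolding base_def using sub A' evenL L3 by (intro trans_energy_interleave) auto
  also have "\<dots> < energy h L \<sigma>" using lower unfolding e A'_def by simp
  finally obtain u where u: "u \<in> U" "stab_level h L \<sigma> \<le> ereal (u - energy h L \<sigma>)"
    using stab_level_le [OF r' \<sigma>] by auto
  have "u - energy h L \<sigma> \<le> \<Gamma>" using u(1) by (auto simp: U_def split: if_splits)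
  then show "stab_level h L \<sigma> \<le> ereal \<Gamma>" by (intro order_trans [OF u(2)]) simp
  assume "A \<noteq> {}"
  then have "u - energy h L \<sigma> < \<Gamma>" using u(1) by (simp add: U_def less_diff_eq diff_less_eq ac_simps)
  then show "stab_level h L \<sigma> < ereal \<Gamma>" by (intro order.strict_trans1 [OF u(2)]) simp
qed

section \<open>Identification of the metastable states\<close>

lemma relax_interleave:
  assumes "A \<in> {{}, torus L}" "B \<in> {{}, torus L}"
  shows "relax h L (interleave L A B) = interleave L B A"
proof -
  have const: "spin A j = spin A i" "spin B j = spin B i" if "i \<in> torus L" "j \<in> torus L" for i j
    using assms that by (auto simp: spin_def)
  \<comment> \<open>All four neighbours have the other parity and so carry one common spin; the
    field \<open>h < 4\<close> cannot reverse the sign of their sum.\<close>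
  have "nbsum L (interleave L A B) i = 4 * interleave L B A i" if i: "i \<in> torus L" for i
  proof -
    have s: "interleave L A B j = interleave L B A i"
      if "j \<in> torus L" "even (fst j + snd j) \<longleftrightarrow> odd (fst i + snd i)" for j
      using that i const [OF i that(1)] by (auto simp: interleave_def)
    have "even (fst (left L i) + snd (left L i)) \<longleftrightarrow> odd (fst i + snd i)"
      "even (fst (down L i) + snd (down L i)) \<longleftrightarrow> odd (fst i + snd i)"
      using i evenL L_ge by (auto simp: left_def down_def torus_def)
    then show ?thesis
      using i L_ge even_shift [OF evenL i] shifts_in_torus [OF i] by (simp add: nbsum_eq s)
  qed
  moreover have "interleave L B A i = 1 \<or> interleave L B A i = -1" if "i \<in> torus L" for i
    using that by (auto simp: interleave_def spin_def)
  ultimately have "relax h L (interleave L A B) i = interleave L B A i" if "i \<in> torus L" for i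
    using that h by (fastforce simp: relax_def)
  moreover have "relax h L (interleave L A B) i = interleave L B A i" if "i \<notin> torus L" for i
    using that by (simp add: relax_def interleave_def)
  ultimately have "relax h L (interleave L A B) i = interleave L B A i" for i by blast
  then show ?thesis by (rule ext)
qed

lemma lower_all_plus:
  assumes "\<sigma> \<in> configs L" "layer L \<sigma> (relax h L \<sigma>) = torus L" "layer L (relax h L \<sigma>) \<sigma> = torus L"
  shows "lower h L \<sigma> = {}"
proof -
  have "energy h L \<sigma> \<le> energy h L \<eta>" if "\<eta> \<in> configs L" for \<eta>
    unfolding energy_base [OF assms(1)] energy_base [OF that] assms(2,3)
    by (intro add_mono ising_layer_ge_torus order_refl)
  then show ?thesis by (force simp: lower_def)
qed

lemma special_configs:
  "all_minus L = interleave L {} {}"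
  "chess_even L = interleave L (torus L) {}"
  "chess_odd L = interleave L {} (torus L)"
  by (auto simp: all_minus_def chess_even_def chess_odd_def interleave_def spin_def intro!: restrict_ext)

lemma special_configs_iff:
  assumes "\<sigma> \<in> configs L"
  shows "\<sigma> \<in> {all_minus L, chess_even L, chess_odd L} \<longleftrightarrow>
    (layer L \<sigma> (relax h L \<sigma>), layer L (relax h L \<sigma>) \<sigma>) \<in> {({}, {}), (torus L, {}), ({}, torus L)}"
proof
  assume "\<sigma> \<in> {all_minus L, chess_even L, chess_odd L}"
  then show "(layer L \<sigma> (relax h L \<sigma>), layer L (relax h L \<sigma>) \<sigma>) \<in> {({}, {}), (torus L, {}), ({}, torus L)}"
    by (auto simp: special_configs relax_interleave layer_interleave)
next
  assume "(layer L \<sigma> (relax h L \<sigma>), layer L (relax h L \<sigma>) \<sigma>) \<in> {({}, {}), (torus L, {}), ({}, torus L)}"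
  then show "\<sigma> \<in> {all_minus L, chess_even L, chess_odd L}"
    using interleave_layer [OF assms relax_in_configs [of h L \<sigma>]] by (auto simp: special_configs)
qed

lemma stab_level_special:
  assumes "\<sigma> \<in> {all_minus L, chess_even L, chess_odd L}"
  shows "\<sigma> \<in> configs L" "stab_level h L \<sigma> = ereal \<Gamma>"
proof -
  show \<sigma>: "\<sigma> \<in> configs L" using assms by (auto simp: special_configs)
  let ?A = "layer L \<sigma> (relax h L \<sigma>)" and ?B = "layer L (relax h L \<sigma>) \<sigma>"
  have AB: "(?A, ?B) \<in> {({}, {}), (torus L, {}), ({}, torus L)}"
    using special_configs_iff [OF \<sigma>] assms by blast
  have ne: "{} \<noteq> torus L" using L_ge by (auto simp: torus_def)
  have "stab_level h L \<sigma> \<le> ereal \<Gamma>"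
    using AB stab_level_le_Gamma(1) [OF \<sigma>, of ?A ?B] stab_level_le_Gamma(1) [OF \<sigma>, of ?B ?A] ne by fastforce
  moreover have "ereal \<Gamma> \<le> stab_level h L \<sigma>"
    using AB stab_level_ge_both_empty [OF \<sigma>] stab_level_ge_one_empty [OF \<sigma>] by auto
  ultimately show "stab_level h L \<sigma> = ereal \<Gamma>" by (rule antisym)
qed

text \<open>Either some layer is neither empty nor full, and growing it gives a strict bound, or
  both are full and nothing lies lower.\<close>

lemma stab_level_other:
  assumes \<sigma>: "\<sigma> \<in> configs L" "\<sigma> \<notin> {all_minus L, chess_even L, chess_odd L}"
  shows "stab_level h L \<sigma> < ereal \<Gamma> \<or> \<sigma> \<in> stable_states h L \<and> stab_level h L \<sigma> = \<infinity>"
proof -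
  let ?A = "layer L \<sigma> (relax h L \<sigma>)" and ?B = "layer L (relax h L \<sigma>) \<sigma>"
  have AB: "(?A, ?B) \<notin> {({}, {}), (torus L, {}), ({}, torus L)}"
    using special_configs_iff [OF \<sigma>(1)] \<sigma>(2) by blast
  show ?thesis
  proof (cases "?A = torus L \<and> ?B = torus L")
    case True
    then have "lower h L \<sigma> = {}" using lower_all_plus [OF \<sigma>(1)] by blast
    then show ?thesis using \<sigma>(1) by (fastforce simp: stab_level_def stable_states_def lower_def not_less)
  next
    case False
    then consider "?A \<noteq> torus L" "?A \<noteq> {}" | "?B \<noteq> torus L" "?B \<noteq> {}" using AB by fastforce
    then show ?thesis
      using stab_level_le_Gamma(2) [OF \<sigma>(1), of ?A ?B] stab_level_le_Gamma(2) [OF \<sigma>(1), of ?B ?A] by cases simp_all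
  qed
qed

lemma Gamma_m_eq: "Gamma_m h L = ereal \<Gamma>"
  unfolding Gamma_m_def
proof (rule Max_eqI)
  show "finite (stab_level h L ` (configs L - stable_states h L))" by simp
  show "v \<le> ereal \<Gamma>" if v: "v \<in> stab_level h L ` (configs L - stable_states h L)" for v
    
  proof -
    obtain \<sigma> where \<sigma>: "\<sigma> \<in> configs L" "\<sigma> \<notin> stable_states h L" "v = stab_level h L \<sigma>" using v by blast
    show ?thesis
      using \<sigma> stab_level_special(2) [of \<sigma>] stab_level_other [of \<sigma>]
      by (cases "\<sigma> \<in> {all_minus L, chess_even L, chess_odd L}") (auto intro: less_imp_le)
  qed
  \<comment> \<open>A finite stability level means that a lower configuration exists, so
    \<open>all_minus L\<close> takes part in the maximum.\<close>
  have "lower h L (all_minus L) \<noteq> {}"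
    using stab_level_special(2) [of "all_minus L"] by (auto simp: stab_level_def)
  then have "all_minus L \<notin> stable_states h L" by (fastforce simp: lower_def stable_states_def)
  then show "ereal \<Gamma> \<in> stab_level h L ` (configs L - stable_states h L)"
    using stab_level_special [of "all_minus L"] by (intro image_eqI [of _ _ "all_minus L"]) auto
qed

lemma metastable_states_eq: "metastable_states h L = {all_minus L, chess_even L, chess_odd L}"
proof (rule set_eqI)
  fix \<sigma>
  show "\<sigma> \<in> metastable_states h L \<longleftrightarrow> \<sigma> \<in> {all_minus L, chess_even L, chess_odd L}"
    using stab_level_special [of \<sigma>] stab_level_other [of \<sigma>]
    unfolding metastable_states_def Gamma_m_eq
    by (cases "\<sigma> \<in> {all_minus L, chess_even L, chess_odd L}") auto
qed

end

theorem theorem3p2: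
  "\<exists>h0::real. 0 < h0 \<and> h0 \<le> 1 \<and>
     (\<forall>h::real. 0 < h \<and> h < h0 \<longrightarrow>
        (\<exists>L0::nat. \<forall>L\<ge>L0. even L \<longrightarrow>
           Gamma_m h L = ereal (Gamma_PCA h) \<and>
           metastable_states h L = {all_minus L, chess_even L, chess_odd L}))"
proof (intro exI [of _ "1/4"] conjI allI impI)
  \<comment> \<open>\<open>h < 1/4\<close> forces \<open>l \<ge> 9\<close>, on which the bound
    \<open>Gamma_ge\<close> rests.\<close>
  fix h :: real assume h: "0 < h \<and> h < 1/4"
  define l where "l = nat (crit_length h)"
  have pos: "0 \<le> \<lfloor>2 / h\<rfloor>" using h by simp
  have l_eq: "real l = of_int \<lfloor>2 / h\<rfloor> + 1" "of_int (crit_length h) = real l"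
    using pos by (simp_all add: l_def crit_length_def)
  have "of_int \<lfloor>2 / h\<rfloor> \<le> 2 / h" "2 / h < of_int \<lfloor>2 / h\<rfloor> + 1" by linarith+
  then have "real l - 1 \<le> 2 / h" "2 / h < real l" unfolding l_eq by linarith+
  then have bounds: "h * (real l - 1) \<le> 2" "2 < h * real l" using h by (simp_all add: field_simps)
  show "\<exists>L0. \<forall>L\<ge>L0. even L \<longrightarrow> Gamma_m h L = ereal (Gamma_PCA h) \<and>
      metastable_states h L = {all_minus L, chess_even L, chess_odd L}"
  \<comment> \<open>This threshold is the assumption \<open>l * l < L\<close> of the locale.\<close>
  proof (intro exI [of _ "Suc (l * l)"] allI impI)
    fix L assume "Suc (l * l) \<le> L" "even L"
    then interpret critical h L l using h bounds by unfold_locales auto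
    have "\<Gamma> = Gamma_PCA h" by (simp add: \<Gamma>_def Gamma_PCA_def l_eq(2) algebra_simps)
    then show "Gamma_m h L = ereal (Gamma_PCA h) \<and>
        metastable_states h L = {all_minus L, chess_even L, chess_odd L}"
      using Gamma_m_eq metastable_states_eq by simp
  qed
qed auto

end
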